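(* Assume that $\mathbb P=\mathbb Q$ and that for any $k\in\{1,\ldots,n\}$, $\alpha_k>\lim_{x\to+\infty}l(x)$. 1. The value function satisfies $V_t=\widehat V_t$ a.s. for $t=0,\ldots,n-1$, where $$\widehat V_{n-1}=\mathbb E[S_n|\mathcal F_{n-1}]+l^{-1}(\alpha_n),$$ $$\widehat V_{k-1}=\mathbb E[\widehat V_k|\mathcal F_{k-1}]+\mathbb E\Big[\big\{S_k-\widehat V_k+\lambda_k\big\}^+\Big|\mathcal F_{k-1}\Big]\mathbf 1_{\{\mathbb E[l(\widehat V_k-S_k)|\mathcal F_{k-1}]>\alpha_k\}},\quad k<n,$$ where $\lambda_k\in\mathcal F_{k-1}$ is the solution of $$\mathbb E\Big[l\big(\lambda_k\vee(\widehat V_k-S_k)\big)\Big|\mathcal F_{k-1}\Big]=\alpha_k.$$ 2. If the loss function is $l(x)=x^-$, with $\alpha_k>0$ for all $k$, then the value function satisfies $V_t=\widehat V_t$ a.s. for $t=0,\ldots,n-1$, where $$\widehat V_{n-1}=\mathbb E[S_n|\mathcal F_{n-1}]-\alpha_n,$$ $$\widehat V_{k-1}=\max\big\{\mathbb E[\widehat V_k|\mathcal F_{k-1}],\ \mathbb E[\widehat V_k\vee S_k-\alpha_k|\mathcal F_{k-1}]\big\},\quad k<n.$$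
   Context: Setting: $(\Omega,\mathcal F,\mathbb P)$ is a probability space with a discrete filtration $\mathbb F=(\mathcal F_k)_{k=0}^n$, $n\ge 1$, with $\mathcal F_0$ trivial; $\mathbb Q$ is a probability measure equivalent to $\mathbb P$; $S_0=0$ and $S_k=P_1+\dots+P_k$, where each $P_i$ is $\mathcal F_i$-measurable with $\mathbb E^{\mathbb Q}[|P_i|]<\infty$. The loss function $l:\mathbf R\to\mathbf R$ is convex, decreasing (in the weak sense) and bounded from below; $l^{-1}(\alpha):=\inf\{x\in\mathbf R\,|\,l(x)\leq\alpha\}$; $\alpha_1,\ldots,\alpha_n$ are real numbers. The notation $M\in\mathcal F_k$ means that $M$ is an $\mathcal F_k$-measurable random variable; $x^+=\max(x,0)$, $x^-=\max(-x,0)$, $a\vee b=\max(a,b)$. When $\mathbb P=\mathbb Q$, $\mathbb E$ denotes the common expectation. The value function (time-consistent constraint) is the process $(V_k)_{0\le k\le n}$ defined backward by $V_n=-\infty$ and, for $k\in\{1,\ldots,n\}$, $$V_{k-1}=\operatorname*{ess\,inf}_{M\in\mathcal F_k}\{\mathbb E^{\mathbb Q}[M|\mathcal F_{k-1}] : M\geq V_k \text{ and } \mathbb E^{\mathbb P}[l(M-S_k)|\mathcal F_{k-1}]\leq\alpha_k\}.$$ *)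

theory Defs
  imports "HOL-Probability.Probability"
begin

text \<open>
  Conditional expectation of an extended real random variable, as the difference of the
  conditional expectations of its positive and negative parts (\<^const>\<open>e2ennreal\<close> truncates
  negative values to 0).  The library's \<^const>\<open>real_cond_exp\<close> is not usable for
  variables that are not assumed integrable: it replaces infinite values by 0.
  In \<^typ>\<open>ereal\<close> the difference of two infinities is \<^term>\<open>\<infinity>::ereal\<close>, so a
  variable whose conditional expectation is undefined never lowers an infimum of
  conditional expectations.
\<close>

definition cexp :: "'a measure \<Rightarrow> 'a measure \<Rightarrow> ('a \<Rightarrow> ereal) \<Rightarrow> 'a \<Rightarrow> ereal" where
  "cexp M G X \<omega> =
     enn2ereal (nn_cond_exp M G (\<lambda>w. e2ennreal (X w)) \<omega>)
     - enn2ereal (nn_cond_exp M G (\<lambda>w. e2ennreal (- X w)) \<omega>)"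

definition is_ess_inf :: "'a measure \<Rightarrow> ('a \<Rightarrow> ereal) set \<Rightarrow> ('a \<Rightarrow> ereal) \<Rightarrow> bool" where
  "is_ess_inf M \<Phi> Z \<longleftrightarrow>
     Z \<in> borel_measurable M \<and>
     (\<forall>X\<in>\<Phi>. AE \<omega> in M. Z \<omega> \<le> X \<omega>) \<and>
     (\<forall>Y\<in>borel_measurable M. (\<forall>X\<in>\<Phi>. AE \<omega> in M. Y \<omega> \<le> X \<omega>) \<longrightarrow> (AE \<omega> in M. Y \<omega> \<le> Z \<omega>))"

text \<open>
  The infimum is taken in the extended reals: it is \<^term>\<open>-\<infinity>::ereal\<close> when \<open>l\<close> is
  constant and the level lies above that constant.
\<close>

definition loss_inv :: "(real \<Rightarrow> real) \<Rightarrow> real \<Rightarrow> ereal" where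
  "loss_inv l a = (INF x\<in>{x. l x \<le> a}. ereal x)"

text \<open>
  A decreasing loss function extended monotonically to the extended reals.  The values at
  the infinities matter only for constant \<open>l\<close>, when the value function is identically
  \<^term>\<open>-\<infinity>::ereal\<close>.
\<close>

definition loss_ext :: "(real \<Rightarrow> real) \<Rightarrow> ereal \<Rightarrow> ereal" where
  "loss_ext l x =
     (case x of ereal r \<Rightarrow> ereal (l r) | PInfty \<Rightarrow> (INF r. ereal (l r)) | MInfty \<Rightarrow> (SUP r. ereal (l r)))"

definition admissible ::
    "'a measure \<Rightarrow> 'a measure \<Rightarrow> 'a measure \<Rightarrow> (real \<Rightarrow> real) \<Rightarrow> real \<Rightarrow> ('a \<Rightarrow> real) \<Rightarrow> ('a \<Rightarrow> ereal)
      \<Rightarrow> ('a \<Rightarrow> real) set" where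
  "admissible P G H l a S V =
     {M \<in> borel_measurable H.
        (AE \<omega> in P. V \<omega> \<le> ereal (M \<omega>)) \<and>
        (AE \<omega> in P. cexp P G (\<lambda>w. ereal (l (M w - S w))) \<omega> \<le> ereal a)}"

text \<open>
  The essential infimum is taken among the random variables measurable with respect to
  \<open>F (k - 1)\<close>, like the members of the family; hence the process is adapted.  The
  recursion determines \<open>V\<close> up to null sets.
\<close>

definition value_process ::
    "'a measure \<Rightarrow> 'a measure \<Rightarrow> (nat \<Rightarrow> 'a measure) \<Rightarrow> (nat \<Rightarrow> 'a \<Rightarrow> real) \<Rightarrow> (real \<Rightarrow> real) \<Rightarrow> (nat \<Rightarrow> real)
      \<Rightarrow> nat \<Rightarrow> (nat \<Rightarrow> 'a \<Rightarrow> ereal) \<Rightarrow> bool" where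
  "value_process P Q F S l \<alpha> n V \<longleftrightarrow>
     V n = (\<lambda>_. -\<infinity>) \<and>
     (\<forall>k\<in>{1..n}.
        is_ess_inf (restr_to_subalg P (F (k - 1)))
          {cexp Q (F (k - 1)) (\<lambda>w. ereal (M w)) |M.
             M \<in> admissible P (F (k - 1)) (F k) l (\<alpha> k) (S k) (V k)}
          (V (k - 1)))"

definition excess ::
    "'a measure \<Rightarrow> 'a measure \<Rightarrow> (real \<Rightarrow> real) \<Rightarrow> real \<Rightarrow> ('a \<Rightarrow> ereal) \<Rightarrow> 'a set" where
  "excess P G l a Y = {\<omega> \<in> space P. cexp P G (\<lambda>w. loss_ext l (Y w)) \<omega> > ereal a}"

text \<open>
  The equation for the level is required only on the excess event: elsewhere it has in
  general no solution, and the term containing the level is multiplied by 0.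
\<close>

definition is_level ::
    "'a measure \<Rightarrow> 'a measure \<Rightarrow> (real \<Rightarrow> real) \<Rightarrow> real \<Rightarrow> ('a \<Rightarrow> ereal) \<Rightarrow> ('a \<Rightarrow> real) \<Rightarrow> bool" where
  "is_level P G l a Y \<Lambda> \<longleftrightarrow>
     \<Lambda> \<in> borel_measurable G \<and>
     (AE \<omega> in P. \<omega> \<in> excess P G l a Y \<longrightarrow>
        cexp P G (\<lambda>w. loss_ext l (max (ereal (\<Lambda> w)) (Y w))) \<omega> = ereal a)"

definition explicit_value ::
    "'a measure \<Rightarrow> (nat \<Rightarrow> 'a measure) \<Rightarrow> (nat \<Rightarrow> 'a \<Rightarrow> real) \<Rightarrow> (real \<Rightarrow> real) \<Rightarrow> (nat \<Rightarrow> real) \<Rightarrow> nat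
      \<Rightarrow> (nat \<Rightarrow> 'a \<Rightarrow> real) \<Rightarrow> (nat \<Rightarrow> 'a \<Rightarrow> ereal) \<Rightarrow> bool" where
  "explicit_value P F S l \<alpha> n \<Lambda> W \<longleftrightarrow>
     (\<forall>t<n. W t \<in> borel_measurable (F t)) \<and>
     (AE \<omega> in P. W (n - 1) \<omega> = cexp P (F (n - 1)) (\<lambda>w. ereal (S n w)) \<omega> + loss_inv l (\<alpha> n)) \<and>
     (\<forall>k\<in>{1..<n}.
        is_level P (F (k - 1)) l (\<alpha> k) (\<lambda>w. W k w - ereal (S k w)) (\<Lambda> k) \<and>
        (AE \<omega> in P. W (k - 1) \<omega> =
           cexp P (F (k - 1)) (W k) \<omega>
           + cexp P (F (k - 1)) (\<lambda>w. max (ereal (S k w) - W k w + ereal (\<Lambda> k w)) 0) \<omega>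
             * indicator (excess P (F (k - 1)) l (\<alpha> k) (\<lambda>w. W k w - ereal (S k w))) \<omega>))"

definition explicit_value_neg_part ::
    "'a measure \<Rightarrow> (nat \<Rightarrow> 'a measure) \<Rightarrow> (nat \<Rightarrow> 'a \<Rightarrow> real) \<Rightarrow> (nat \<Rightarrow> real) \<Rightarrow> nat
      \<Rightarrow> (nat \<Rightarrow> 'a \<Rightarrow> ereal) \<Rightarrow> bool" where
  "explicit_value_neg_part P F S \<alpha> n W \<longleftrightarrow>
     (\<forall>t<n. W t \<in> borel_measurable (F t)) \<and>
     (AE \<omega> in P. W (n - 1) \<omega> = cexp P (F (n - 1)) (\<lambda>w. ereal (S n w)) \<omega> - ereal (\<alpha> n)) \<and>
     (\<forall>k\<in>{1..<n}. AE \<omega> in P. W (k - 1) \<omega> =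
        max (cexp P (F (k - 1)) (W k) \<omega>)
            (cexp P (F (k - 1)) (\<lambda>w. max (W k w) (ereal (S k w)) - ereal (\<alpha> k)) \<omega>))"

lemma (in sigma_finite_subalgebra) cexp_eq_real_cond_exp:
  assumes f: "integrable M f"
  shows "AE x in M. cexp M F (\<lambda>w. ereal (f w)) x = ereal (real_cond_exp M F f x)"
proof -
  have fin: "AE x in M. nn_cond_exp M F (\<lambda>w. ennreal (g w)) x \<noteq> \<infinity>" if g: "integrable M g" for g
  proof -
    have [measurable]: "g \<in> borel_measurable M"
      using g by simp
    have "(\<integral>\<^sup>+x. nn_cond_exp M F (\<lambda>w. ennreal (g w)) x \<partial>M) = (\<integral>\<^sup>+x. ennreal (g x) \<partial>M)"
      using nn_cond_exp_intg[of "\<lambda>_. 1" "\<lambda>w. ennreal (g w)"] by simp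
    also have "\<dots> \<le> (\<integral>\<^sup>+x. ennreal (norm (g x)) \<partial>M)"
      by (intro nn_integral_mono ennreal_leI) simp
    also have "\<dots> < \<infinity>"
      using g by (simp add: integrable_iff_bounded)
    finally show ?thesis
      by (intro nn_integral_PInf_AE) auto
  qed
  have "integrable M (\<lambda>x. - f x)"
    using f by simp
  from fin[OF f] fin[OF this] show ?thesis
  proof eventually_elim
    case (elim x)
    have "enn2ereal y = ereal (enn2real y)" if "y \<noteq> \<infinity>" for y :: ennreal
      using that by (cases y) (auto simp: enn2ereal_ennreal)
    with elim show ?case
      by (simp add: cexp_def real_cond_exp_def)
  qed
qed

lemma is_ess_inf_unique:
  assumes "is_ess_inf M \<Phi> Z" "is_ess_inf M \<Phi> Z'"
  shows "AE \<omega> in M. Z \<omega> = Z' \<omega>"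
proof -
  have "AE \<omega> in M. Z \<omega> \<le> Z' \<omega>" "AE \<omega> in M. Z' \<omega> \<le> Z \<omega>"
    using assms by (auto simp: is_ess_inf_def)
  then show ?thesis
    by eventually_elim auto
qed

lemma (in finite_measure) is_ess_inf_exists:
  assumes meas: "\<Phi> \<subseteq> borel_measurable M"
  shows "\<exists>Z. is_ess_inf M \<Phi> Z"
proof -
  define U where "U C q = (\<Union>X\<in>C. {\<omega> \<in> space M. X \<omega> < ereal q})"
    for C :: "('a \<Rightarrow> ereal) set" and q
  define \<C> where "\<C> = {C. countable C \<and> C \<subseteq> \<Phi>}"
  have U_sets: "U C q \<in> sets M" if "C \<in> \<C>" for C q
  proof -
    have "{\<omega> \<in> space M. X \<omega> < ereal q} \<in> sets M" if "X \<in> C" for X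
      using meas that \<open>C \<in> \<C>\<close> by (intro borel_measurable_less) (auto simp: \<C>_def)
    then show ?thesis
      using that unfolding U_def \<C>_def by (intro sets.countable_UN') auto
  qed
  have max_ex: "\<exists>C\<in>\<C>. \<forall>C'\<in>\<C>. measure M (U C' q) \<le> measure M (U C q)" for q
  proof -
    define s where "s = (SUP C\<in>\<C>. measure M (U C q))"
    have ne: "\<C> \<noteq> {}"
      unfolding \<C>_def by auto
    have bdd: "bdd_above ((\<lambda>C. measure M (U C q)) ` \<C>)"
      by (intro bdd_aboveI[of _ "measure M (space M)"]) (auto intro: bounded_measure)
    have "\<exists>C\<in>\<C>. s - 1 / Suc i < measure M (U C q)" for i :: nat
      unfolding s_def using ne bdd by (subst less_cSUP_iff[symmetric]) auto
    then obtain C where C: "\<And>i. C i \<in> \<C>" "\<And>i::nat. s - 1 / Suc i < measure M (U (C i) q)"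
      by metis
    define D where "D = (\<Union>i. C i)"
    have D: "D \<in> \<C>"
      using C(1) unfolding D_def \<C>_def by auto
    have "s - 1 / Suc i \<le> measure M (U D q)" for i :: nat
    proof -
      have "measure M (U (C i) q) \<le> measure M (U D q)"
        by (intro finite_measure_mono U_sets D) (auto simp: U_def D_def)
      with C(2)[of i] show ?thesis
        by simp
    qed
    moreover have "(\<lambda>i. s - 1 / Suc i) \<longlonglongrightarrow> s - 0"
      by (intro tendsto_intros LIMSEQ_Suc[OF lim_1_over_n])
    ultimately have "s \<le> measure M (U D q)"
      by (intro LIMSEQ_le_const2[of _ s]) auto
    moreover have "measure M (U C' q) \<le> s" if "C' \<in> \<C>" for C'
      unfolding s_def by (intro cSUP_upper bdd that)
    ultimately show ?thesis
      using D by (meson order_trans)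
  qed
  then obtain C where C: "\<And>q. C q \<in> \<C>"
      "\<And>q C'. C' \<in> \<C> \<Longrightarrow> measure M (U C' q) \<le> measure M (U (C q) q)"
    by metis
  define D where "D = (\<Union>q\<in>\<rat>. C q)"
  have D: "countable D" "D \<subseteq> \<Phi>"
    using C(1) unfolding D_def \<C>_def by (auto intro: countable_rat)
  define Z where "Z \<omega> = (INF X\<in>D. X \<omega>)" for \<omega>
  have Z_meas: "Z \<in> borel_measurable M"
    unfolding Z_def using D meas by (intro borel_measurable_INF) auto
  have Z_le: "AE \<omega> in M. Z \<omega> \<le> X \<omega>" if X: "X \<in> \<Phi>" for X
  proof -
    have "AE \<omega> in M. X \<omega> < ereal q \<longrightarrow> Z \<omega> < ereal q" if q: "q \<in> \<rat>" for q
    proof -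
      let ?C = "insert X (C q)"
      have C': "?C \<in> \<C>"
        using X C(1)[of q] unfolding \<C>_def by auto
      have sub: "U (C q) q \<subseteq> U ?C q"
        unfolding U_def by auto
      have "measure M (U ?C q - U (C q) q) = measure M (U ?C q) - measure M (U (C q) q)"
        by (intro finite_measure_Diff U_sets C C' sub)
      also have "\<dots> \<le> 0"
        using C(2)[OF C', of q] by simp
      finally have "measure M (U ?C q - U (C q) q) = 0"
        by (simp add: measure_le_0_iff)
      then have "U ?C q - U (C q) q \<in> null_sets M"
        by (auto simp: emeasure_eq_measure intro!: U_sets C C' sets.Diff)
      then have "AE \<omega> in M. \<omega> \<notin> U ?C q - U (C q) q"
        by (rule AE_not_in)
      then show ?thesis
        using AE_space
      proof eventually_elim
        case (elim \<omega>)
        show ?case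
        proof
          assume "X \<omega> < ereal q"
          then obtain X' where "X' \<in> C q" "X' \<omega> < ereal q"
            using elim unfolding U_def by auto
          then show "Z \<omega> < ereal q"
            unfolding Z_def INF_less_iff D_def using q by auto
        qed
      qed
    qed
    then have "AE \<omega> in M. \<forall>q\<in>\<rat>. X \<omega> < ereal q \<longrightarrow> Z \<omega> < ereal q"
      by (subst AE_ball_countable) (auto intro: countable_rat)
    then show ?thesis
    proof eventually_elim
      case (elim \<omega>)
      show ?case
      proof (rule ccontr)
        assume "\<not> Z \<omega> \<le> X \<omega>"
        then have "X \<omega> < Z \<omega>"
          by simp
        then obtain q where "X \<omega> < ereal (real_of_rat q)" "ereal (real_of_rat q) < Z \<omega>"
          using ereal_dense3 by blast
        with elim show False
          by (auto dest!: bspec[of _ _ "real_of_rat q"])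
      qed
    qed
  qed
  have "AE \<omega> in M. Y \<omega> \<le> Z \<omega>"
    if "\<forall>X\<in>\<Phi>. AE \<omega> in M. Y \<omega> \<le> X \<omega>" for Y :: "'a \<Rightarrow> ereal"
  proof -
    have "AE \<omega> in M. \<forall>X\<in>D. Y \<omega> \<le> X \<omega>"
      using that D by (subst AE_ball_countable) auto
    then show ?thesis
      by eventually_elim (auto simp: Z_def intro: INF_greatest)
  qed
  then show ?thesis
    using Z_meas Z_le unfolding is_ess_inf_def by blast
qed

end

theory Submission
  imports Defs
begin

text \<open>
  If \<open>l\<close> is constant, the constraint is void and every value is \<open>-\<infinity>\<close>.  Otherwise \<open>l\<close> is
  strictly decreasing on \<open>{l \<ge> \<alpha>}\<close> and attains \<open>\<alpha>\<close> at a unique point.  In one step, with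
  \<open>U\<close> the value at time \<open>k\<close> and \<open>Y = U - S\<close>, the candidate optimum is \<open>T = S + max \<lambda> Y\<close> on the
  excess event and \<open>T = U\<close> elsewhere.  For an admissible \<open>N\<close>, convexity gives
  \<open>N \<ge> T + (l (N - S) - l (max \<lambda> Y)) / l' \<lambda>\<close> on the excess event, where \<open>l' \<lambda>\<close> is a subgradient.
  It is negative, bounded away from 0 (since \<open>l \<lambda> \<ge> \<alpha>\<close>) and known at time \<open>k - 1\<close>, so the last
  term has nonnegative conditional expectation and \<open>T\<close> is optimal.  Integrability propagates
  backwards because \<open>\<lambda>\<close> is at most the point where \<open>l\<close> equals \<open>\<alpha>\<close>.  For the negative part,
  \<open>max \<lambda> Y = max 0 Y - l (max \<lambda> Y)\<close> turns the expectation of \<open>T\<close> into the second formula.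
\<close>

section \<open>Conditional expectations of extended real variables\<close>

context finite_measure_subalgebra
begin

lemma sets_subalg: "A \<in> sets F \<Longrightarrow> A \<in> sets M"
  using subalg by (auto simp: subalgebra_def)

lemma space_in_subalg: "space M \<in> sets F"
  using subalg sets.top[of F] by (simp add: subalgebra_def)

lemma borel_measurable_subalg: "f \<in> borel_measurable F \<Longrightarrow> f \<in> borel_measurable M"
  by (rule measurable_from_subalg[OF subalg])

lemma borel_measurable_cexp [measurable]: "cexp M F X \<in> borel_measurable F"
  unfolding cexp_def by measurable

text \<open>The indicator of an event of \<open>F\<close> can be pulled out of the conditional
  expectation, so an inequality known only on that event carries over there. The versions restricted
  to \<open>A\<close> serve arguments on the excess event.\<close>

lemma nn_cond_exp_mono_on:
  assumes A: "A \<in> sets F" and [measurable]: "f \<in> borel_measurable M" "g \<in> borel_measurable M"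
    and le: "AE x in M. x \<in> A \<longrightarrow> f x \<le> g x"
  shows "AE x in M. x \<in> A \<longrightarrow> nn_cond_exp M F f x \<le> nn_cond_exp M F g x"
proof -
  note [measurable] = A sets_subalg[OF A]
  have "AE x in M. nn_cond_exp M F (\<lambda>x. indicator A x * f x) x
      \<le> nn_cond_exp M F (\<lambda>x. indicator A x * g x) x"
    using le by (intro nn_cond_exp_mono) (auto elim!: eventually_mono simp: indicator_def)
  moreover have "AE x in M. indicator A x * nn_cond_exp M F f x = nn_cond_exp M F (\<lambda>x. indicator A x * f x) x"
    by (intro nn_cond_exp_prod) auto
  moreover have "AE x in M. indicator A x * nn_cond_exp M F g x = nn_cond_exp M F (\<lambda>x. indicator A x * g x) x"
    by (intro nn_cond_exp_prod) auto
  ultimately show ?thesis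
    by eventually_elim (auto simp: indicator_def split: if_splits)
qed

text \<open>On \<open>A\<close> the positive part grows and the negative part shrinks; subtraction
  in \<open>ereal\<close> respects both, also where infinity minus infinity gives infinity.\<close>

lemma cexp_mono_on:
  assumes A: "A \<in> sets F" and [measurable]: "X \<in> borel_measurable M" "Y \<in> borel_measurable M"
    and le: "AE x in M. x \<in> A \<longrightarrow> X x \<le> Y x"
  shows "AE x in M. x \<in> A \<longrightarrow> cexp M F X x \<le> cexp M F Y x"
proof -
  have "AE x in M. x \<in> A \<longrightarrow> nn_cond_exp M F (\<lambda>w. e2ennreal (X w)) x \<le> nn_cond_exp M F (\<lambda>w. e2ennreal (Y w)) x"
    using le by (intro nn_cond_exp_mono_on A) (auto elim!: eventually_mono intro: e2ennreal_mono)
  moreover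
  have "AE x in M. x \<in> A \<longrightarrow> nn_cond_exp M F (\<lambda>w. e2ennreal (- Y w)) x \<le> nn_cond_exp M F (\<lambda>w. e2ennreal (- X w)) x"
    using le by (intro nn_cond_exp_mono_on A) (auto elim!: eventually_mono intro: e2ennreal_mono)
  ultimately show ?thesis
    unfolding cexp_def
    by eventually_elim (auto intro!: ereal_minus_mono simp: less_eq_ennreal.rep_eq)
qed

lemma cexp_mono:
  assumes "X \<in> borel_measurable M" "Y \<in> borel_measurable M" "AE x in M. X x \<le> Y x"
  shows "AE x in M. cexp M F X x \<le> cexp M F Y x"
proof -
  have "AE x in M. x \<in> space M \<longrightarrow> cexp M F X x \<le> cexp M F Y x"
    using assms by (intro cexp_mono_on space_in_subalg) auto
  then show ?thesis
    by (auto elim: AE_mp)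
qed

lemma cexp_cong_on:
  assumes A: "A \<in> sets F" and "X \<in> borel_measurable M" "Y \<in> borel_measurable M"
    and eq: "AE x in M. x \<in> A \<longrightarrow> X x = Y x"
  shows "AE x in M. x \<in> A \<longrightarrow> cexp M F X x = cexp M F Y x"
proof -
  have "AE x in M. x \<in> A \<longrightarrow> cexp M F X x \<le> cexp M F Y x"
    using eq by (intro cexp_mono_on assms) (auto elim!: eventually_mono)
  moreover have "AE x in M. x \<in> A \<longrightarrow> cexp M F Y x \<le> cexp M F X x"
    using eq by (intro cexp_mono_on assms) (auto elim!: eventually_mono)
  ultimately show ?thesis
    by eventually_elim auto
qed

lemma cexp_cong_AE:
  assumes "X \<in> borel_measurable M" "Y \<in> borel_measurable M" "AE x in M. X x = Y x"
  shows "AE x in M. cexp M F X x = cexp M F Y x"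
proof -
  have "AE x in M. x \<in> space M \<longrightarrow> cexp M F X x = cexp M F Y x"
    using assms by (intro cexp_cong_on space_in_subalg) auto
  then show ?thesis
    by (auto elim: AE_mp)
qed

lemma cexp_const: "AE x in M. cexp M F (\<lambda>_. c) x = c"
proof -
  have "AE x in M. e2ennreal c = nn_cond_exp M F (\<lambda>_. e2ennreal c) x"
    by (rule nn_cond_exp_F_meas) simp
  moreover have "AE x in M. e2ennreal (- c) = nn_cond_exp M F (\<lambda>_. e2ennreal (- c)) x"
    by (rule nn_cond_exp_F_meas) simp
  ultimately show ?thesis
  proof eventually_elim
    case (elim x)
    show ?case
      unfolding cexp_def elim[symmetric]
      by (cases c; cases "0 \<le> c") (auto simp: enn2ereal_ennreal ennreal_neg e2ennreal_neg zero_ennreal.rep_eq)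
  qed
qed

text \<open>Tested by integrals over events of \<open>F\<close>. It serves to let a truncation level
  tend to -\<infinity> when levels are constructed.\<close>

lemma nn_cond_exp_monotone_convergence:
  assumes [measurable]: "\<And>i. f i \<in> borel_measurable M" and inc: "\<And>i x. f i x \<le> f (Suc i) x"
  shows "AE x in M. (SUP i. nn_cond_exp M F (f i) x) = nn_cond_exp M F (\<lambda>x. SUP i. f i x) x"
proof (rule nn_cond_exp_charact)
  fix A assume A: "A \<in> sets F"
  note [measurable] = A sets_subalg[OF A] borel_measurable_nn_cond_exp2
  \<comment> \<open>The conditional expectations are ordered only almost surely, so the almost sure
    form of monotone convergence is applied to them.\<close>
  have mono: "AE x in M. \<forall>i. nn_cond_exp M F (f i) x \<le> nn_cond_exp M F (f (Suc i)) x"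
    unfolding AE_all_countable using inc by (auto intro!: nn_cond_exp_mono)
  have "(\<integral>\<^sup>+x\<in>A. (SUP i. f i x) \<partial>M) = (\<integral>\<^sup>+x. (SUP i. f i x * indicator A x) \<partial>M)"
    by (simp add: SUP_mult_right_ennreal)
  also have "\<dots> = (SUP i. \<integral>\<^sup>+x\<in>A. f i x \<partial>M)"
    using inc by (intro nn_integral_monotone_convergence_SUP incseq_SucI)
      (auto simp: le_fun_def intro: mult_right_mono)
  also have "\<dots> = (SUP i. \<integral>\<^sup>+x\<in>A. nn_cond_exp M F (f i) x \<partial>M)"
  proof (intro SUP_cong refl)
    fix i
    have "(\<integral>\<^sup>+x. indicator A x * nn_cond_exp M F (f i) x \<partial>M) = (\<integral>\<^sup>+x. indicator A x * f i x \<partial>M)"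
      by (rule nn_cond_exp_intg) auto
    then show "(\<integral>\<^sup>+x\<in>A. f i x \<partial>M) = (\<integral>\<^sup>+x\<in>A. nn_cond_exp M F (f i) x \<partial>M)"
      by (simp add: mult.commute)
  qed
  also have "\<dots> = (\<integral>\<^sup>+x. (SUP i. nn_cond_exp M F (f i) x * indicator A x) \<partial>M)"
    using mono by (intro nn_integral_monotone_convergence_SUP_AE[symmetric])
      (auto elim!: eventually_mono intro: mult_right_mono)
  also have "\<dots> = (\<integral>\<^sup>+x\<in>A. (SUP i. nn_cond_exp M F (f i) x) \<partial>M)"
    by (simp add: SUP_mult_right_ennreal)
  finally show "(\<integral>\<^sup>+x\<in>A. (SUP i. f i x) \<partial>M) = (\<integral>\<^sup>+x\<in>A. (SUP i. nn_cond_exp M F (f i) x) \<partial>M)" .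
qed auto

text \<open>Both parts of \<open>f\<close> are traded for the single nonnegative variable
  \<open>f - c\<close>. This rests on \<open>(f - c) + f^- + c^+ = f^+ + c^-\<close>, where
  \<open>f^-\<close> is at most \<open>c^-\<close> and hence has a finite conditional expectation
  that cancels. It applies to every loss, as \<open>l\<close> is bounded below.\<close>

lemma cexp_bounded_below:
  assumes [measurable]: "f \<in> borel_measurable M" and ge: "\<And>x. c \<le> f x"
  shows "AE x in M. cexp M F (\<lambda>w. ereal (f w)) x
    = enn2ereal (nn_cond_exp M F (\<lambda>w. ennreal (f w - c)) x) + ereal c"
proof -
  let ?E = "nn_cond_exp M F"
  let ?cp = "ennreal c" and ?cm = "ennreal (- c)"
  have c: "AE x in M. ?cp = ?E (\<lambda>_. ?cp) x" "AE x in M. ?cm = ?E (\<lambda>_. ?cm) x"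
    by (rule nn_cond_exp_F_meas; simp)+
  have s1: "AE x in M. ?E (\<lambda>w. ennreal (f w - c)) x + ?E (\<lambda>w. ennreal (- f w)) x
      = ?E (\<lambda>w. ennreal (f w - c) + ennreal (- f w)) x"
    by (rule nn_cond_exp_sum) auto
  have s2: "AE x in M. ?E (\<lambda>w. ennreal (f w - c) + ennreal (- f w)) x + ?E (\<lambda>_. ?cp) x
      = ?E (\<lambda>w. ennreal (f w - c) + ennreal (- f w) + ?cp) x"
    by (rule nn_cond_exp_sum) auto
  have s3: "AE x in M. ?E (\<lambda>w. ennreal (f w)) x + ?E (\<lambda>_. ?cm) x
      = ?E (\<lambda>w. ennreal (f w) + ?cm) x"
    by (rule nn_cond_exp_sum) auto
  have "ennreal (f w - c) + ennreal (- f w) + ?cp = ennreal (f w) + ?cm" for w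
    using ge[of w]
    by (cases "0 \<le> c"; cases "0 \<le> f w")
       (simp_all add: ennreal_neg ennreal_plus[symmetric] del: ennreal_plus)
  then have eq: "(\<lambda>w. ennreal (f w - c) + ennreal (- f w) + ?cp) = (\<lambda>w. ennreal (f w) + ?cm)"
    by auto
  have "AE x in M. ?E (\<lambda>w. ennreal (- f w)) x \<le> ?E (\<lambda>_. ?cm) x"
    using ge by (intro nn_cond_exp_mono AE_I2 ennreal_leI) auto
  with c s1 s2 s3 show ?thesis
  proof eventually_elim
    case (elim x)
    have fin: "?E (\<lambda>w. ennreal (- f w)) x \<noteq> \<infinity>"
      using elim(6) elim(2)[symmetric] by (auto simp: top_unique)
    have "?E (\<lambda>w. ennreal (f w - c)) x + ?E (\<lambda>w. ennreal (- f w)) x + ?cp = ?E (\<lambda>w. ennreal (f w)) x + ?cm"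
      using elim eq by metis
    then have "enn2ereal (?E (\<lambda>w. ennreal (f w - c)) x) + enn2ereal (?E (\<lambda>w. ennreal (- f w)) x) + enn2ereal ?cp
        = enn2ereal (?E (\<lambda>w. ennreal (f w)) x) + enn2ereal ?cm"
      by (metis plus_ennreal.rep_eq)
    moreover have "enn2ereal ?cp = ereal (max 0 c)" "enn2ereal ?cm = ereal (max 0 (- c))"
      by (auto simp: max_def enn2ereal_ennreal ennreal_neg zero_ennreal.rep_eq)
    moreover obtain b where "enn2ereal (?E (\<lambda>w. ennreal (- f w)) x) = ereal b"
      using fin by (cases "?E (\<lambda>w. ennreal (- f w)) x") (auto simp: enn2ereal_ennreal)
    ultimately show ?case
      unfolding cexp_def
      by (cases "enn2ereal (?E (\<lambda>w. ennreal (f w - c)) x)"; cases "enn2ereal (?E (\<lambda>w. ennreal (f w)) x)")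
         (auto simp: max_def split: if_splits)
  qed
qed

lemma cexp_F_meas_bounded_below:
  assumes [measurable]: "f \<in> borel_measurable F" and ge: "\<And>x. c \<le> f x"
  shows "AE x in M. cexp M F (\<lambda>w. ereal (f w)) x = ereal (f x)"
proof -
  have "AE x in M. ennreal (f x - c) = nn_cond_exp M F (\<lambda>w. ennreal (f w - c)) x"
    by (rule nn_cond_exp_F_meas) auto
  with cexp_bounded_below[OF borel_measurable_subalg ge, OF assms(1)] show ?thesis
  proof eventually_elim
    case (elim x)
    show ?case
      unfolding elim(1) elim(2)[symmetric] using ge[of x] by (simp add: enn2ereal_ennreal)
  qed
qed

text \<open>Integrating the conditional bound over \<open>A\<close> bounds the integral of
  \<open>f - c\<close>, because the measure is finite. A conditional loss constraint thus makes the
  loss integrable.\<close>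

lemma integrable_on_cexp_le:
  assumes A: "A \<in> sets F" and [measurable]: "f \<in> borel_measurable M" and ge: "\<And>x. c \<le> f x"
    and le: "AE x in M. x \<in> A \<longrightarrow> cexp M F (\<lambda>w. ereal (f w)) x \<le> ereal b"
  shows "integrable M (\<lambda>x. f x * indicator A x)"
proof -
  note [measurable] = A sets_subalg[OF A] borel_measurable_nn_cond_exp2
  have "(\<integral>\<^sup>+x. indicator A x * ennreal (f x - c) \<partial>M)
      = (\<integral>\<^sup>+x. indicator A x * nn_cond_exp M F (\<lambda>x. ennreal (f x - c)) x \<partial>M)"
    by (intro nn_cond_exp_intg[symmetric]) auto
  also have "\<dots> \<le> (\<integral>\<^sup>+x. ennreal (b - c) \<partial>M)"
  proof (rule nn_integral_mono_AE)
    show "AE x in M. indicator A x * nn_cond_exp M F (\<lambda>x. ennreal (f x - c)) x \<le> ennreal (b - c)"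
      using le cexp_bounded_below[OF assms(2) ge]
    proof eventually_elim
      case (elim x)
      show ?case
      proof (cases "x \<in> A")
        case True
        then have "enn2ereal (nn_cond_exp M F (\<lambda>x. ennreal (f x - c)) x) + ereal c \<le> ereal b"
          using elim by simp
        then have "nn_cond_exp M F (\<lambda>x. ennreal (f x - c)) x \<le> ennreal (b - c)"
          by (cases "nn_cond_exp M F (\<lambda>x. ennreal (f x - c)) x")
             (auto simp: enn2ereal_ennreal intro: ennreal_leI)
        then show ?thesis using True by simp
      qed simp
    qed
  qed
  also have "\<dots> < \<infinity>"
    by (simp add: ennreal_mult_less_top less_top[symmetric] ennreal_mult_eq_top_iff)
  also have "(\<lambda>x. indicator A x * ennreal (f x - c)) = (\<lambda>x. ennreal (norm ((f x - c) * indicator A x)))"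
    using ge by (auto simp: indicator_def)
  finally have "(\<integral>\<^sup>+x. ennreal (norm ((f x - c) * indicator A x)) \<partial>M) < \<infinity>" .
  then have "integrable M (\<lambda>x. (f x - c) * indicator A x)"
    by (intro integrableI_bounded) auto
  moreover have "integrable M (\<lambda>x. c * indicator A x)"
    by (intro integrable_mult_right integrable_real_indicator) (auto simp: emeasure_finite less_top[symmetric])
  ultimately have "integrable M (\<lambda>x. (f x - c) * indicator A x + c * indicator A x)"
    by (rule Bochner_Integration.integrable_add)
  then show ?thesis
    by (simp add: algebra_simps)
qed

lemma real_cond_exp_cong_on:
  assumes A: "A \<in> sets F" and fg: "integrable M f" "integrable M g"
    and eq: "AE x in M. x \<in> A \<longrightarrow> f x = g x"
  shows "AE x in M. x \<in> A \<longrightarrow> real_cond_exp M F f x = real_cond_exp M F g x"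
proof -
  have [measurable]: "f \<in> borel_measurable M" "g \<in> borel_measurable M"
    using fg by auto
  have "AE x in M. x \<in> A \<longrightarrow> cexp M F (\<lambda>w. ereal (f w)) x = cexp M F (\<lambda>w. ereal (g w)) x"
    using eq by (intro cexp_cong_on A) (auto elim!: eventually_mono)
  with cexp_eq_real_cond_exp[OF fg(1)] cexp_eq_real_cond_exp[OF fg(2)] show ?thesis
    by eventually_elim auto
qed

end

section \<open>Levels of a convex loss\<close>

locale loss_level =
  fixes l :: "real \<Rightarrow> real" and a :: real
  assumes convex: "convex_on UNIV l" and antimono: "antimono l" and bdd_below: "bdd_below (range l)"
    and nonconstant: "\<exists>x y. l x \<noteq> l y" and below: "\<exists>x. l x < a"
begin

text \<open>The right derivative of \<open>l\<close>: by convexity the difference quotients decrease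
  as \<open>t\<close> approaches \<open>x\<close> from the right, so their infimum is the
  limit.\<close>

definition "slope x = Inf ((\<lambda>t. (l x - l t) / (x - t)) ` {x<..})"

definition "low = (INF x. l x)"

definition "crit = (SOME x. l x = a)"

lemma low_le: "low \<le> l x"
  unfolding low_def by (rule cINF_lower[OF bdd_below]) simp

lemma low_less: "low < a"
  using below low_le by (metis le_less_trans)

lemma tangent: "l x + slope x * (y - x) \<le> l y"
  using convex_le_Inf_differential[OF convex, of x y] by (simp add: slope_def)

text \<open>Add the tangent inequalities at \<open>x\<close> and at \<open>y\<close>.\<close>

lemma slope_mono: "x \<le> y \<Longrightarrow> slope x \<le> slope y"
proof (cases "x = y")
  case False
  assume "x \<le> y"
  with False have "x < y" by simp
  have "0 \<le> (slope y - slope x) * (y - x)"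
    using tangent[of x y] tangent[of y x] by (simp add: algebra_simps)
  with \<open>x < y\<close> show ?thesis
    by (simp add: zero_le_mult_iff)
qed simp

lemma l_anti: "x \<le> y \<Longrightarrow> l y \<le> l x"
  using antimono by (rule antimonoD)

lemma continuous_l: "continuous_on UNIV l"
  by (rule convex_on_continuous[OF open_UNIV convex])

lemma measurable_l [measurable]: "l \<in> borel_measurable borel"
  by (rule borel_measurable_continuous_onI[OF continuous_l])

lemma measurable_slope [measurable]: "slope \<in> borel_measurable borel"
  by (intro borel_measurable_mono monoI slope_mono)

text \<open>A tangent of negative slope forces \<open>l\<close> up to height \<open>a\<close> far
  enough to the left, and \<open>below\<close> brings it under \<open>a\<close> on the right; the
  intermediate value theorem gives a crossing.\<close>

lemma l_crit: "l crit = a"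
proof -
  obtain x y where xy: "x < y" "l x > l y"
    using nonconstant antimono by (metis antimonoD linorder_neqE_linordered_idom order_less_le)
  have neg: "slope x < 0"
    using tangent[of x y] xy by (smt (verit) mult_nonneg_nonneg)
  \<comment> \<open>At or to the left of the point where the tangent at \<open>x\<close> has height
    \<open>a\<close>, so that \<open>l z\<close> is at least \<open>a\<close>.\<close>
  define z where "z = min x (x + (a - l x) / slope x)"
  have "a \<le> l x + slope x * (z - x)"
  proof -
    have "slope x * ((a - l x) / slope x) \<le> slope x * (z - x)"
      using neg by (intro mult_left_mono_neg) (auto simp: z_def)
    then show ?thesis using neg by simp
  qed
  then have z: "a \<le> l z"
    using tangent[of x z] by simp
  obtain y0 where y0: "l y0 < a" using below by auto
  have "z \<le> y0"
    using z y0 l_anti[of y0 z] by linarith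
  then have "\<exists>x. z \<le> x \<and> x \<le> y0 \<and> l x = a"
    using z y0 continuous_on_subset[OF continuous_l] by (intro IVT2') auto
  then have "\<exists>x. l x = a"
    by blast
  then show ?thesis
    unfolding crit_def by (rule someI_ex)
qed

text \<open>From a height of at least \<open>a\<close> the function must still fall to some
  \<open>l y0\<close> below \<open>a\<close>, and the tangent at \<open>x\<close> lies below
  \<open>l\<close> at \<open>y0\<close>.\<close>

lemma slope_neg_if: "a \<le> l x \<Longrightarrow> slope x < 0"
proof -
  assume x: "a \<le> l x"
  obtain y0 where y0: "l y0 < a" using below by auto
  have "x < y0"
    using x y0 l_anti[of y0 x] by linarith
  then show ?thesis
    using tangent[of x y0] x y0 by (smt (verit) mult_nonneg_nonneg)
qed

text \<open>Strictness comes from the tangent at the right endpoint, whose slope is negative since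
  \<open>l y\<close> is at least \<open>a\<close>.\<close>

lemma strict_anti:
  assumes "x < y" "a \<le> l y"
  shows "l y < l x"
proof -
  have "0 < slope y * (x - y)"
    using assms slope_neg_if by (intro mult_neg_neg) auto
  then show ?thesis
    using tangent[of y x] by linarith
qed

lemma le_crit_iff: "x \<le> crit \<longleftrightarrow> a \<le> l x"
  using l_anti[of x crit] strict_anti[of crit x] l_crit by linarith

lemma crit_le_iff: "crit \<le> x \<longleftrightarrow> l x \<le> a"
  using l_anti[of crit x] strict_anti[of x crit] l_crit by linarith

lemma slope_neg: "x \<le> crit \<Longrightarrow> slope x < 0"
  by (simp add: slope_neg_if le_crit_iff)

lemma loss_inv_eq: "loss_inv l a = ereal crit"
  unfolding loss_inv_def
  by (intro antisym INF_lower INF_greatest) (auto simp: crit_le_iff[symmetric])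

text \<open>A floor \<open>y\<close> can only reduce the drop of \<open>l\<close> between
  \<open>x\<close> and \<open>z\<close>. Hence continuity of \<open>l\<close> controls the
  dependence on the level uniformly in \<open>y\<close>.\<close>

lemma l_max_le: "x \<le> z \<Longrightarrow> l (max x y) \<le> l (max z y) + (l x - l z)"
  using l_anti[of x y] l_anti[of z y] l_anti[of y z] l_anti[of x z] unfolding max_def
  by (smt (verit))

lemma l_max_anti: "x \<le> z \<Longrightarrow> l (max z y) \<le> l (max x y)"
  by (intro l_anti) auto

text \<open>The slope at \<open>\<lambda>\<close> is a Lagrange multiplier: \<open>max \<lambda> y\<close> minimises
  \<open>N - l N / slope \<lambda>\<close> over \<open>N \<ge> y\<close>.\<close>

lemma lagrange:
  assumes "x \<le> crit" "y \<le> N"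
  shows "max x y + (l N - l (max x y)) / slope x \<le> N"
proof -
  have neg: "slope x < 0" using assms slope_neg by simp
  have "slope x * (N - max x y) \<le> l N - l (max x y)"
  proof (cases "y \<le> x")
    case True
    then show ?thesis using tangent[of x N] by (simp add: max_def)
  next
    case False
    \<comment> \<open>Where the floor \<open>y\<close> binds, the tangent at \<open>y\<close> is
      used; its slope is at least that at \<open>x\<close>, and \<open>N - y\<close> is
      nonnegative.\<close>
    have "slope x * (N - y) \<le> slope y * (N - y)"
      using False assms by (intro mult_right_mono slope_mono) auto
    then show ?thesis using tangent[of y N] False by (simp add: max_def)
  qed
  then show ?thesis
    using neg by (simp add: divide_simps) (simp add: algebra_simps)
qed

end

lemma loss_ext_ereal [simp]: "loss_ext l (ereal r) = ereal (l r)"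
  by (simp add: loss_ext_def)

section \<open>Conditional levels: upper bound and measurable existence\<close>

locale level_problem = finite_measure_subalgebra M F + loss_level l a
  for M :: "'a measure" and F :: "'a measure" and l :: "real \<Rightarrow> real" and a :: real
begin

abbreviation "exc Y \<equiv> excess M F l a (\<lambda>w. ereal (Y w))"

abbreviation "level Y \<equiv> is_level M F l a (\<lambda>w. ereal (Y w))"

lemma exc_sets: "exc Y \<in> sets F"
proof -
  have "space M = space F"
    using subalg by (simp add: subalgebra_def)
  then show ?thesis
    unfolding excess_def by simp
qed

text \<open>Taking the maximum with \<open>Y\<close> lowers the loss, and \<open>\<Lambda>\<close>
  is known at \<open>F\<close>, so the level equation forces \<open>a \<le> l (\<Lambda> w)\<close>.
  The bound later gives both integrability and a negative slope at the level.\<close>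

lemma level_le_crit:
  assumes [measurable]: "Y \<in> borel_measurable M" and lev: "level Y \<Lambda>"
  shows "AE w in M. w \<in> exc Y \<longrightarrow> \<Lambda> w \<le> crit"
proof -
  have L: "\<Lambda> \<in> borel_measurable F" using lev by (simp add: is_level_def)
  note [measurable] = L borel_measurable_subalg[OF L]
  have "AE w in M. cexp M F (\<lambda>w. ereal (l (max (\<Lambda> w) (Y w)))) w \<le> cexp M F (\<lambda>w. ereal (l (\<Lambda> w))) w"
    by (intro cexp_mono AE_I2) (auto intro: l_anti)
  moreover have "AE w in M. cexp M F (\<lambda>w. ereal (l (\<Lambda> w))) w = ereal (l (\<Lambda> w))"
    by (rule cexp_F_meas_bounded_below[OF _ low_le]) measurable
  moreover have "AE w in M. w \<in> exc Y \<longrightarrow> cexp M F (\<lambda>w. ereal (l (max (\<Lambda> w) (Y w)))) w = ereal a"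
    using lev by (simp add: is_level_def flip: ereal_max)
  ultimately show ?thesis
    by eventually_elim (auto simp: le_crit_iff)
qed

lemma level_cexp:
  assumes "level Y \<Lambda>"
  shows "AE w in M. w \<in> exc Y \<longrightarrow> cexp M F (\<lambda>w. ereal (l (max (\<Lambda> w) (Y w)))) w = ereal a"
  using assms by (simp add: is_level_def flip: ereal_max)

text \<open>The level is the infimum of the rationals \<open>r\<close> for which the conditional
  loss of \<open>max r Y\<close> is at most \<open>a\<close>. Using rationals keeps it measurable
  and leaves countably many null sets; continuity of \<open>l\<close> yields equality at the
  infimum. Losses are shifted by \<open>low\<close> to make them nonnegative.\<close>

lemma level_exists:
  assumes [measurable]: "Y \<in> borel_measurable M"
  shows "\<exists>\<Lambda>. level Y \<Lambda>"
proof -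
  define g where "g r = nn_cond_exp M F (\<lambda>w. ennreal (l (max r (Y w)) - low))" for r
  define ga where "ga = ennreal (a - low)"
  define R where "R w = (INF r\<in>\<rat>. if g r w \<le> ga then ereal r else \<infinity>)" for w
  \<comment> \<open>\<open>real_of_ereal\<close> sends an infinite \<open>R w\<close> to 0; almost
    surely on the excess event \<open>R w\<close> turns out to be finite.\<close>
  define \<Lambda> where "\<Lambda> w = real_of_ereal (R w)" for w
  define h where "h = nn_cond_exp M F (\<lambda>w. ennreal (l (max (\<Lambda> w) (Y w)) - low))"
  have [measurable]: "g r \<in> borel_measurable F" for r
    unfolding g_def by measurable
  have [measurable]: "R \<in> borel_measurable F"
    unfolding R_def by (intro borel_measurable_INF countable_rat) measurable
  have L: "\<Lambda> \<in> borel_measurable F"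
    unfolding \<Lambda>_def by measurable
  note [measurable] = L borel_measurable_subalg[OF L]
  \<comment> \<open>Bounds \<open>R\<close> from above: an integer beyond \<open>crit\<close> is
    feasible.\<close>
  have 1: "AE w in M. \<forall>r\<in>\<rat>. g r w \<le> ennreal (l r - low)"
  proof (subst AE_ball_countable[OF countable_rat], intro ballI)
    fix r :: real
    have "AE w in M. ennreal (l r - low) = nn_cond_exp M F (\<lambda>w. ennreal (l r - low)) w"
      by (rule nn_cond_exp_F_meas) simp
    moreover have "AE w in M. g r w \<le> nn_cond_exp M F (\<lambda>w. ennreal (l r - low)) w"
      unfolding g_def by (intro nn_cond_exp_mono AE_I2 ennreal_leI) (auto intro: l_anti)
    ultimately show "AE w in M. g r w \<le> ennreal (l r - low)"
      by eventually_elim simp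
  qed
  have 2: "AE w in M. \<forall>r\<in>\<rat>. \<forall>s\<in>\<rat>. r \<le> s \<longrightarrow> g s w \<le> g r w"
  proof (subst AE_ball_countable[OF countable_rat], intro ballI,
      subst AE_ball_countable[OF countable_rat], intro ballI)
    fix r s :: real
    have "AE w in M. g s w \<le> g r w" if "r \<le> s"
      unfolding g_def using that
      by (intro nn_cond_exp_mono AE_I2 ennreal_leI diff_right_mono l_max_anti) auto
    then show "AE w in M. r \<le> s \<longrightarrow> g s w \<le> g r w"
      by (cases "r \<le> s") auto
  qed
  \<comment> \<open>Bounds \<open>R\<close> from below on the excess event: as the level tends to
    -\<infinity>, the conditional loss increases to that of \<open>Y\<close>, which exceeds
    \<open>a\<close> there, so some \<open>- real i\<close> is already infeasible.\<close>
  have 3: "AE w in M. w \<in> exc Y \<longrightarrow> (\<exists>i::nat. ga < g (- real i) w)"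
  proof -
    have sup: "AE w in M. (SUP i::nat. g (- real i) w)
        = nn_cond_exp M F (\<lambda>w. SUP i::nat. ennreal (l (max (- real i) (Y w)) - low)) w"
      unfolding g_def
      by (intro nn_cond_exp_monotone_convergence) (auto intro!: ennreal_leI diff_right_mono l_max_anti)
    have sup_eq: "(SUP i::nat. ennreal (l (max (- real i) y) - low)) = ennreal (l y - low)" for y
    proof (intro antisym SUP_least)
      fix i :: nat
      show "ennreal (l (max (- real i) y) - low) \<le> ennreal (l y - low)"
        by (intro ennreal_leI diff_right_mono l_anti) simp
    next
      obtain i :: nat where "- y \<le> real i" using real_arch_simple by blast
      then have "max (- real i) y = y" by simp
      then show "ennreal (l y - low) \<le> (SUP i::nat. ennreal (l (max (- real i) y) - low))"
        by (intro SUP_upper2[of i]) auto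
    qed
    have "AE w in M. cexp M F (\<lambda>w. ereal (l (Y w))) w
        = enn2ereal (nn_cond_exp M F (\<lambda>w. ennreal (l (Y w) - low)) w) + ereal low"
      by (rule cexp_bounded_below[OF _ low_le]) measurable
    with sup[unfolded sup_eq] show ?thesis
    proof (eventually_elim, intro impI)
      fix w assume eq: "(SUP i::nat. g (- real i) w) = nn_cond_exp M F (\<lambda>w. ennreal (l (Y w) - low)) w"
        "cexp M F (\<lambda>w. ereal (l (Y w))) w
          = enn2ereal (nn_cond_exp M F (\<lambda>w. ennreal (l (Y w) - low)) w) + ereal low"
        and w: "w \<in> exc Y"
      have "ereal a < enn2ereal (nn_cond_exp M F (\<lambda>w. ennreal (l (Y w) - low)) w) + ereal low"
        using w eq by (simp add: excess_def)
      then have "ga < nn_cond_exp M F (\<lambda>w. ennreal (l (Y w) - low)) w"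
        unfolding ga_def
        by (cases "nn_cond_exp M F (\<lambda>w. ennreal (l (Y w) - low)) w")
          (auto simp: enn2ereal_ennreal ennreal_less_iff low_less less_imp_le)
      then show "\<exists>i::nat. ga < g (- real i) w"
        unfolding eq(1)[symmetric] by (simp add: less_SUP_iff)
    qed
  qed
  \<comment> \<open>For random levels known at \<open>F\<close>, \<open>l_max_le\<close> bounds the
    change in conditional loss by \<open>l (p w) - l (q w)\<close>, which is itself known at
    \<open>F\<close>. This links \<open>h\<close>, built from the random \<open>\<Lambda>\<close>,
    to the versions \<open>g r\<close> at fixed rationals.\<close>
  have compare: "AE w in M. w \<in> A \<longrightarrow> nn_cond_exp M F (\<lambda>w. ennreal (l (max (p w) (Y w)) - low)) w
      \<le> nn_cond_exp M F (\<lambda>w. ennreal (l (max (q w) (Y w)) - low)) w + ennreal (l (p w) - l (q w))"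
    if A: "A \<in> sets F" and pq: "\<And>w. w \<in> A \<Longrightarrow> p w \<le> q w" "p \<in> borel_measurable F" "q \<in> borel_measurable F"
    for A and p q :: "'a \<Rightarrow> real"
  proof -
    note [measurable] = pq(2,3) pq(2,3)[THEN borel_measurable_subalg]
    have "AE w in M. w \<in> A \<longrightarrow> nn_cond_exp M F (\<lambda>w. ennreal (l (max (p w) (Y w)) - low)) w
      \<le> nn_cond_exp M F (\<lambda>w. ennreal (l (max (q w) (Y w)) - low) + ennreal (l (p w) - l (q w))) w"
    proof (intro nn_cond_exp_mono_on A AE_I2 impI)
      fix w assume "w \<in> A"
      then have "p w \<le> q w" by (rule pq)
      then show "ennreal (l (max (p w) (Y w)) - low)
          \<le> ennreal (l (max (q w) (Y w)) - low) + ennreal (l (p w) - l (q w))"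
        using l_max_le[of "p w" "q w" "Y w"] low_le l_anti[of "p w" "q w"]
        by (subst ennreal_plus[symmetric]) (auto intro!: ennreal_leI simp: algebra_simps)
    qed measurable
    moreover have "AE w in M. nn_cond_exp M F (\<lambda>w. ennreal (l (max (q w) (Y w)) - low)) w
        + nn_cond_exp M F (\<lambda>w. ennreal (l (p w) - l (q w))) w
      = nn_cond_exp M F (\<lambda>w. ennreal (l (max (q w) (Y w)) - low) + ennreal (l (p w) - l (q w))) w"
      by (rule nn_cond_exp_sum) measurable
    moreover have "AE w in M. ennreal (l (p w) - l (q w)) = nn_cond_exp M F (\<lambda>w. ennreal (l (p w) - l (q w))) w"
      by (rule nn_cond_exp_F_meas) measurable
    ultimately show ?thesis
      by eventually_elim auto
  qed
  have 4: "AE w in M. \<forall>r\<in>\<rat>. \<Lambda> w \<le> r \<longrightarrow> h w \<le> g r w + ennreal (l (\<Lambda> w) - l r)"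
  proof (subst AE_ball_countable[OF countable_rat], intro ballI)
    fix r :: real
    have "{w \<in> space F. \<Lambda> w \<le> r} \<in> sets F" by measurable
    from compare[OF this, of \<Lambda> "\<lambda>_. r"] show "AE w in M. \<Lambda> w \<le> r \<longrightarrow> h w \<le> g r w + ennreal (l (\<Lambda> w) - l r)"
      using subalg AE_space unfolding h_def g_def by (auto simp: subalgebra_def elim: AE_mp)
  qed
  have 5: "AE w in M. \<forall>r\<in>\<rat>. r \<le> \<Lambda> w \<longrightarrow> g r w \<le> h w + ennreal (l r - l (\<Lambda> w))"
  proof (subst AE_ball_countable[OF countable_rat], intro ballI)
    fix r :: real
    have "{w \<in> space F. r \<le> \<Lambda> w} \<in> sets F" by measurable
    from compare[OF this, of "\<lambda>_. r" \<Lambda>] show "AE w in M. r \<le> \<Lambda> w \<longrightarrow> g r w \<le> h w + ennreal (l r - l (\<Lambda> w))"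
      using subalg AE_space unfolding h_def g_def by (auto simp: subalgebra_def elim: AE_mp)
  qed
  have 6: "AE w in M. cexp M F (\<lambda>w. ereal (l (max (\<Lambda> w) (Y w)))) w = enn2ereal (h w) + ereal low"
    unfolding h_def by (rule cexp_bounded_below[OF _ low_le]) measurable
  have "AE w in M. w \<in> exc Y \<longrightarrow> cexp M F (\<lambda>w. ereal (l (max (\<Lambda> w) (Y w)))) w = ereal a"
    using 1 2 3 4 5 6
  proof (eventually_elim, intro impI)
    fix w
    assume w: "w \<in> exc Y"
      and E1: "\<forall>r\<in>\<rat>. g r w \<le> ennreal (l r - low)"
      and E2: "\<forall>r\<in>\<rat>. \<forall>s\<in>\<rat>. r \<le> s \<longrightarrow> g s w \<le> g r w"
      and E3: "w \<in> exc Y \<longrightarrow> (\<exists>i::nat. ga < g (- real i) w)"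
      and E4: "\<forall>r\<in>\<rat>. \<Lambda> w \<le> r \<longrightarrow> h w \<le> g r w + ennreal (l (\<Lambda> w) - l r)"
      and E5: "\<forall>r\<in>\<rat>. r \<le> \<Lambda> w \<longrightarrow> g r w \<le> h w + ennreal (l r - l (\<Lambda> w))"
      and E6: "cexp M F (\<lambda>w. ereal (l (max (\<Lambda> w) (Y w)))) w = enn2ereal (h w) + ereal low"
    have R_le: "R w \<le> ereal r" if "r \<in> \<rat>" "g r w \<le> ga" for r
      unfolding R_def using that by (intro INF_lower2[of r]) auto
    obtain i :: nat where i: "ga < g (- real i) w" using E3 w by auto
    have "ereal (- real i) \<le> R w"
      unfolding R_def
    proof (intro INF_greatest)
      fix r :: real assume r: "r \<in> \<rat>"
      show "ereal (- real i) \<le> (if g r w \<le> ga then ereal r else \<infinity>)"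
      proof (cases "g r w \<le> ga")
        case True
        then have "\<not> r \<le> - real i"
          using E2 r i by (meson Rats_minus_iff Rats_of_nat leD order_trans)
        with True show ?thesis by simp
      qed simp
    qed
    moreover obtain r0 :: nat where r0: "crit \<le> real r0" using real_arch_simple by blast
    have "R w \<le> ereal (real r0)"
    proof (rule R_le)
      have "g (real r0) w \<le> ennreal (l (real r0) - low)" using E1 by simp
      also have "\<dots> \<le> ga"
        unfolding ga_def using r0 by (intro ennreal_leI) (simp add: crit_le_iff)
      finally show "g (real r0) w \<le> ga" .
    qed simp
    ultimately have R_eq: "R w = ereal (\<Lambda> w)"
      unfolding \<Lambda>_def by (cases "R w") auto
    have cont: "\<exists>d>0. \<forall>s. \<bar>s - \<Lambda> w\<bar> < d \<longrightarrow> \<bar>l s - l (\<Lambda> w)\<bar> < e" if "e > 0" for e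
      using continuous_l that unfolding continuous_on_iff dist_real_def by auto
    \<comment> \<open>Feasible rationals come arbitrarily close to the infimum from above.\<close>
    have "h w \<le> ga"
    proof (rule ennreal_le_epsilon)
      fix e :: real assume "e > 0"
      then obtain d where d: "d > 0" "\<forall>s. \<bar>s - \<Lambda> w\<bar> < d \<longrightarrow> \<bar>l s - l (\<Lambda> w)\<bar> < e"
        using cont by blast
      have "R w < ereal (\<Lambda> w + d)" using R_eq d by simp
      then obtain r where r: "r \<in> \<rat>" "g r w \<le> ga" "r < \<Lambda> w + d"
        unfolding R_def INF_less_iff by (auto split: if_splits)
      have "\<Lambda> w \<le> r" using R_le[OF r(1,2)] R_eq by simp
      with E4 r have "h w \<le> g r w + ennreal (l (\<Lambda> w) - l r)" by simp
      also have "\<dots> \<le> ga + ennreal e"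
        using d(2)[rule_format, of r] r \<open>\<Lambda> w \<le> r\<close> by (intro add_mono ennreal_leI) auto
      finally show "h w \<le> ga + ennreal e" .
    qed
    \<comment> \<open>Every rational below the infimum is infeasible.\<close>
    moreover have "ga \<le> h w"
    proof (rule ennreal_le_epsilon)
      fix e :: real assume "e > 0"
      then obtain d where d: "d > 0" "\<forall>s. \<bar>s - \<Lambda> w\<bar> < d \<longrightarrow> \<bar>l s - l (\<Lambda> w)\<bar> < e"
        using cont by blast
      obtain r where r: "r \<in> \<rat>" "\<Lambda> w - d < r" "r < \<Lambda> w"
        using Rats_dense_in_real[of "\<Lambda> w - d" "\<Lambda> w"] d by auto
      have "ga \<le> g r w" using R_le[OF r(1)] R_eq r(3) by fastforce
      also have "\<dots> \<le> h w + ennreal (l r - l (\<Lambda> w))" using E5 r by simp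
      also have "\<dots> \<le> h w + ennreal e"
        using d(2)[rule_format, of r] r by (intro add_mono ennreal_leI) auto
      finally show "ga \<le> h w + ennreal e" .
    qed
    ultimately have "h w = ga" by (rule antisym)
    then show "cexp M F (\<lambda>w. ereal (l (max (\<Lambda> w) (Y w)))) w = ereal a"
      unfolding E6 ga_def using low_less by (simp add: enn2ereal_ennreal)
  qed
  then have "level Y \<Lambda>"
    using L by (simp add: is_level_def flip: ereal_max)
  then show ?thesis
    by blast
qed

end

lemma measurable_loss_ext [measurable]:
  assumes [measurable]: "l \<in> borel_measurable borel"
  shows "loss_ext l \<in> borel_measurable borel"
proof -
  have "loss_ext l = (\<lambda>x. if x = \<infinity> then (INF r. ereal (l r)) else if x = -\<infinity> then (SUP r. ereal (l r))
      else ereal (l (real_of_ereal x)))"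
  proof
    show "loss_ext l x = (if x = \<infinity> then (INF r. ereal (l r)) else if x = -\<infinity> then (SUP r. ereal (l r))
      else ereal (l (real_of_ereal x)))" for x
      by (cases x) (auto simp: loss_ext_def)
  qed
  then show ?thesis
    by simp
qed

section \<open>From extended to real conditional expectations; attained essential infima\<close>

context finite_measure_subalgebra
begin

text \<open>The variable \<open>f\<close> may fail to be integrable off \<open>A\<close>. Cutting it
  off there makes the rules for \<open>real_cond_exp\<close> available without changing
  \<open>cexp\<close> on \<open>A\<close>.\<close>

lemma real_cond_exp_indicator:
  assumes A: "A \<in> sets F" and [measurable]: "f \<in> borel_measurable M"
    and int: "integrable M (\<lambda>x. f x * indicator A x)"
  shows "AE x in M. ereal (real_cond_exp M F (\<lambda>x. f x * indicator A x) x)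
    = (if x \<in> A then cexp M F (\<lambda>w. ereal (f w)) x else 0)"
proof -
  note [measurable] = A sets_subalg[OF A]
  have "AE x in M. x \<in> A \<longrightarrow> cexp M F (\<lambda>w. ereal (f w * indicator A w)) x = cexp M F (\<lambda>w. ereal (f w)) x"
    by (intro cexp_cong_on A AE_I2) auto
  moreover have "AE x in M. x \<in> space M - A \<longrightarrow> cexp M F (\<lambda>w. ereal (f w * indicator A w)) x = cexp M F (\<lambda>w. 0) x"
    using A space_in_subalg by (intro cexp_cong_on sets.Diff AE_I2) auto
  ultimately show ?thesis
    using cexp_eq_real_cond_exp[OF int] cexp_const[of 0] AE_space
    by eventually_elim auto
qed

text \<open>The infimum is attained at \<open>T\<close>, the candidate that beats every competitor.
  What remains is to pass between null sets of \<open>M\<close> and of its restriction to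
  \<open>F\<close>; the variables compared are measurable for \<open>F\<close>.\<close>

lemma ess_inf_cexp_eq:
  assumes inf: "is_ess_inf (restr_to_subalg M F) {cexp M F (\<lambda>w. ereal (N w)) |N. N \<in> \<A>} Z"
    and T: "T \<in> \<A>" "integrable M T"
    and le: "\<And>N. N \<in> \<A> \<Longrightarrow> AE w in M. ereal (real_cond_exp M F T w) \<le> cexp M F (\<lambda>w. ereal (N w)) w"
  shows "AE w in M. Z w = ereal (real_cond_exp M F T w)"
proof -
  have "AE w in restr_to_subalg M F. Z w \<le> cexp M F (\<lambda>w. ereal (T w)) w"
    using inf T by (auto simp: is_ess_inf_def)
  then have "AE w in M. Z w \<le> cexp M F (\<lambda>w. ereal (T w)) w"
    by (rule AE_restr_to_subalg[OF subalg])
  moreover have "AE w in restr_to_subalg M F. ereal (real_cond_exp M F T w) \<le> Z w"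
  proof -
    have "AE w in restr_to_subalg M F. ereal (real_cond_exp M F T w) \<le> cexp M F (\<lambda>w. ereal (N w)) w"
      if "N \<in> \<A>" for N
      by (rule AE_restr_to_subalg2[OF subalg le[OF that]]) measurable
    moreover have "(\<lambda>w. ereal (real_cond_exp M F T w)) \<in> borel_measurable (restr_to_subalg M F)"
      by (rule measurable_in_subalg[OF subalg]) measurable
    moreover have "AE w in restr_to_subalg M F. Y w \<le> Z w"
      if "Y \<in> borel_measurable (restr_to_subalg M F)"
        "\<forall>X\<in>{cexp M F (\<lambda>w. ereal (N w)) |N. N \<in> \<A>}. AE w in restr_to_subalg M F. Y w \<le> X w" for Y
      using inf that by (simp add: is_ess_inf_def)
    ultimately show ?thesis
      by auto
  qed
  then have "AE w in M. ereal (real_cond_exp M F T w) \<le> Z w"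
    by (rule AE_restr_to_subalg[OF subalg])
  ultimately show ?thesis
    using cexp_eq_real_cond_exp[OF T(2)] by eventually_elim auto
qed

end

section \<open>Uniqueness of the level, and the last time step\<close>

context level_problem
begin

text \<open>On the event \<open>D\<close> where \<open>L1\<close> lies below \<open>L2\<close>, the
  first loss dominates the second while both have conditional expectation \<open>a\<close>, so they
  agree almost surely. Strict monotonicity up to \<open>crit\<close> then forces
  \<open>L2 \<le> Y\<close>. Hence the conditional loss of \<open>Y\<close> equals \<open>a\<close>
  on \<open>D\<close>, which the excess event rules out.\<close>

lemma level_not_less:
  assumes [measurable]: "Y \<in> borel_measurable M" and lev: "level Y L1" "level Y L2"
  shows "AE w in M. w \<in> exc Y \<longrightarrow> \<not> L1 w < L2 w"
proof -
  have L: "L1 \<in> borel_measurable F" "L2 \<in> borel_measurable F"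
    using lev by (auto simp: is_level_def)
  note [measurable] = L L[THEN borel_measurable_subalg] exc_sets[of Y]
  have "space F = space M" using subalg by (simp add: subalgebra_def)
  define D where "D = {w \<in> space F. w \<in> exc Y \<and> L1 w < L2 w}"
  have D: "D \<in> sets F" unfolding D_def by measurable
  note [measurable] = D sets_subalg[OF D]
  define f where "f L w = l (max (L w) (Y w))" for L w
  have level: "AE w in M. w \<in> D \<longrightarrow> cexp M F (\<lambda>w. ereal (f L w)) w = ereal a"
    and int: "integrable M (\<lambda>w. f L w * indicator D w)"
    and cond: "AE w in M. real_cond_exp M F (\<lambda>w. f L w * indicator D w) w = a * indicator D w"
    if "L = L1 \<or> L = L2" for L
  proof -
    have [measurable]: "f L \<in> borel_measurable M"
      using that unfolding f_def by auto
    show lv: "AE w in M. w \<in> D \<longrightarrow> cexp M F (\<lambda>w. ereal (f L w)) w = ereal a"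
      using that level_cexp[OF lev(1)] level_cexp[OF lev(2)]
      unfolding f_def by (auto simp: D_def elim: eventually_mono)
    show i: "integrable M (\<lambda>w. f L w * indicator D w)"
    proof (rule integrable_on_cexp_le[OF D])
      show "low \<le> f L w" for w
        by (simp add: f_def low_le)
      show "AE w in M. w \<in> D \<longrightarrow> cexp M F (\<lambda>w. ereal (f L w)) w \<le> ereal a"
        using lv by eventually_elim simp
    qed measurable
    show "AE w in M. real_cond_exp M F (\<lambda>w. f L w * indicator D w) w = a * indicator D w"
      using real_cond_exp_indicator[OF D _ i] lv by (auto elim!: eventually_elim2)
  qed
  have int12: "integrable M (\<lambda>w. f L1 w * indicator D w - f L2 w * indicator D w)"
    using int by auto
  have "AE w in M. f L1 w * indicator D w - f L2 w * indicator D w = 0"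
  proof (subst integral_nonneg_eq_0_iff_AE[OF int12, symmetric])
    show "AE w in M. 0 \<le> f L1 w * indicator D w - f L2 w * indicator D w"
      by (intro AE_I2) (auto simp: f_def D_def indicator_def intro!: l_max_anti)
    have "(\<integral>w. f L w * indicator D w \<partial>M) = (\<integral>w. a * indicator D w \<partial>M)" if "L = L1 \<or> L = L2" for L
      using real_cond_exp_int(2)[OF int[OF that]] integral_cong_AE[OF _ _ cond[OF that]] by simp
    then show "(\<integral>w. f L1 w * indicator D w - f L2 w * indicator D w \<partial>M) = 0"
      using int by simp
  qed
  then have Y: "AE w in M. w \<in> D \<longrightarrow> L2 w \<le> Y w"
    using level_le_crit[OF assms(1) lev(2)]
  proof eventually_elim
    case (elim w)
    show ?case
    proof
      assume w: "w \<in> D"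
      then have "l (max (L1 w) (Y w)) = l (max (L2 w) (Y w))" "L1 w < L2 w" "a \<le> l (L2 w)"
        using elim by (auto simp: f_def D_def le_crit_iff)
      then show "L2 w \<le> Y w"
        using strict_anti[of "max (L1 w) (Y w)" "L2 w"] by (cases "L2 w \<le> Y w") (auto simp: max_def split: if_splits)
    qed
  qed
  have "AE w in M. w \<in> D \<longrightarrow> cexp M F (\<lambda>w. ereal (f L2 w)) w = cexp M F (\<lambda>w. ereal (l (Y w))) w"
    unfolding f_def using Y by (intro cexp_cong_on D) (auto elim!: eventually_mono simp: max_def)
  with level[of L2, simplified] AE_space show ?thesis
    by eventually_elim (auto simp: D_def excess_def \<open>space F = space M\<close>)
qed

lemma level_unique:
  assumes "Y \<in> borel_measurable M" "level Y L1" "level Y L2"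
  shows "AE w in M. w \<in> exc Y \<longrightarrow> L1 w = L2 w"
  using level_not_less[OF assms] level_not_less[OF assms(1,3,2)]
  by eventually_elim auto

lemma feasible_integrable:
  assumes [measurable]: "N \<in> borel_measurable M" "S \<in> borel_measurable M"
    and "AE w in M. cexp M F (\<lambda>w. ereal (l (N w - S w))) w \<le> ereal a"
  shows "integrable M (\<lambda>w. l (N w - S w))"
proof -
  have "integrable M (\<lambda>w. l (N w - S w) * indicator (space M) w)"
    by (rule integrable_on_cexp_le[OF space_in_subalg, where c = low and b = a])
      (use assms in \<open>auto simp: low_le elim: eventually_mono\<close>)
  then show ?thesis
    by (rule Bochner_Integration.integrable_cong[THEN iffD1, rotated -1]) auto
qed

text \<open>The multiplier inequality at the constant level \<open>crit\<close>: the conditional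
  loss is at most \<open>a\<close> and the slope is negative, so the correction term has a
  nonnegative conditional expectation.\<close>

lemma terminal_optimal:
  assumes S: "integrable M S" and [measurable]: "N \<in> borel_measurable M"
    and feas: "AE w in M. cexp M F (\<lambda>w. ereal (l (N w - S w))) w \<le> ereal a"
  shows "AE w in M. ereal (real_cond_exp M F (\<lambda>w. S w + crit) w) \<le> cexp M F (\<lambda>w. ereal (N w)) w"
proof -
  have [measurable]: "S \<in> borel_measurable M" using S by simp
  have neg: "slope crit < 0" by (simp add: slope_neg)
  have intl: "integrable M (\<lambda>w. l (N w - S w))"
    by (rule feasible_integrable) (use feas in auto)
  have intS: "integrable M (\<lambda>w. S w + crit)"
    using S by simp
  have intd: "integrable M (\<lambda>w. (l (N w - S w) - a) / slope crit)"
    using intl by simp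
  have intla: "integrable M (\<lambda>w. l (N w - S w) - a)"
    using intl by simp
  have "S w + crit + (l (N w - S w) - a) / slope crit \<le> N w" for w
    \<comment> \<open>At the last time \<open>N\<close> has no floor. The choice
      \<open>min crit (N w - S w)\<close> is a valid floor that leaves the maximum at
      \<open>crit\<close>.\<close>
    using lagrange[of crit "min crit (N w - S w)" "N w - S w"] by (simp add: l_crit max_def split: if_splits)
  then have "AE w in M. cexp M F (\<lambda>w. ereal (S w + crit + (l (N w - S w) - a) / slope crit)) w
      \<le> cexp M F (\<lambda>w. ereal (N w)) w"
    by (intro cexp_mono) auto
  moreover have "AE w in M. cexp M F (\<lambda>w. ereal (S w + crit + (l (N w - S w) - a) / slope crit)) w
      = real_cond_exp M F (\<lambda>w. S w + crit + (l (N w - S w) - a) / slope crit) w"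
    by (rule cexp_eq_real_cond_exp[OF Bochner_Integration.integrable_add[OF intS intd]])
  moreover have "AE w in M. real_cond_exp M F (\<lambda>w. S w + crit + (l (N w - S w) - a) / slope crit) w
      = real_cond_exp M F (\<lambda>w. S w + crit) w + real_cond_exp M F (\<lambda>w. (l (N w - S w) - a) / slope crit) w"
    by (rule real_cond_exp_add[OF intS intd])
  moreover have "AE w in M. real_cond_exp M F (\<lambda>w. (l (N w - S w) - a) / slope crit) w
      = real_cond_exp M F (\<lambda>w. l (N w - S w) - a) w / slope crit"
    by (rule real_cond_exp_cdiv[OF intla])
  moreover have "AE w in M. real_cond_exp M F (\<lambda>w. l (N w - S w) - a) w
      = real_cond_exp M F (\<lambda>w. l (N w - S w)) w - real_cond_exp M F (\<lambda>w. a) w"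
    by (intro real_cond_exp_diff intl) simp
  moreover have "AE w in M. real_cond_exp M F (\<lambda>w. a) w = a"
    by (intro real_cond_exp_F_meas) auto
  ultimately show ?thesis
    using feas cexp_eq_real_cond_exp[OF intl]
  proof eventually_elim
    case (elim w)
    have "0 \<le> (real_cond_exp M F (\<lambda>w. l (N w - S w)) w - a) / slope crit"
      using elim neg by (intro divide_nonpos_neg) auto
    then have "ereal (real_cond_exp M F (\<lambda>w. S w + crit) w)
        \<le> ereal (real_cond_exp M F (\<lambda>w. S w + crit + (l (N w - S w) - a) / slope crit) w)"
      using elim by simp
    also have "\<dots> \<le> cexp M F (\<lambda>w. ereal (N w)) w"
      using elim(1) unfolding elim(2) .
    finally show ?case .
  qed
qed

text \<open>With value -\<infinity> at the final time only the loss constraint remains, and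
  \<open>S w + crit\<close> meets it with equality at every point.\<close>

lemma terminal_value:
  assumes H: "subalgebra M H" and S: "integrable M S" "S \<in> borel_measurable H"
    and V: "V = (\<lambda>_. -\<infinity>)"
    and inf: "is_ess_inf (restr_to_subalg M F) {cexp M F (\<lambda>w. ereal (N w)) |N. N \<in> admissible M F H l a S V} Z"
  shows "AE w in M. Z w = ereal (real_cond_exp M F (\<lambda>w. S w + crit) w)"
proof (rule ess_inf_cexp_eq[OF inf])
  have [measurable]: "S \<in> borel_measurable H" by fact
  show "(\<lambda>w. S w + crit) \<in> admissible M F H l a S V"
    using cexp_const[of "ereal a"] by (auto simp: admissible_def V l_crit elim: eventually_mono)
  show "integrable M (\<lambda>w. S w + crit)"
    using S by simp
  fix N assume "N \<in> admissible M F H l a S V"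
  then show "AE w in M. ereal (real_cond_exp M F (\<lambda>w. S w + crit) w) \<le> cexp M F (\<lambda>w. ereal (N w)) w"
    using S by (intro terminal_optimal) (auto simp: admissible_def intro: measurable_from_subalg[OF H])
qed

end

section \<open>One step of the backward recursion\<close>

context level_problem
begin

context
  fixes H :: "'a measure" and U S \<Lambda> :: "'a \<Rightarrow> real"
  assumes H: "subalgebra M H" "subalgebra H F"
    and U: "integrable M U" "U \<in> borel_measurable H"
    and S: "integrable M S" "S \<in> borel_measurable H"
    and lev: "level (\<lambda>w. U w - S w) \<Lambda>"
begin

private abbreviation "A \<equiv> exc (\<lambda>w. U w - S w)"

text \<open>The candidate \<open>T\<close> of the overview, written as \<open>U\<close> plus a gain
  so that its conditional expectation splits into the two terms of the explicit formula.\<close>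

definition "improved w = U w + max (S w - U w + \<Lambda> w) 0 * indicator A w"

private lemma level_meas: "\<Lambda> \<in> borel_measurable F"
  using lev by (simp add: is_level_def)

private lemma meas_M [measurable]: "U \<in> borel_measurable M" "S \<in> borel_measurable M" "\<Lambda> \<in> borel_measurable M"
  using U S level_meas by (auto intro: borel_measurable_subalg)

private lemma A_meas [measurable]: "A \<in> sets F" "A \<in> sets M"
  using exc_sets sets_subalg by auto

lemma improved_measurable: "improved \<in> borel_measurable H"
proof -
  have "A \<in> sets H" "\<Lambda> \<in> borel_measurable H"
    using A_meas H(2) level_meas by (auto simp: subalgebra_def intro: measurable_from_subalg)
  note [measurable] = this U(2) S(2)
  show ?thesis
    unfolding improved_def[abs_def] by measurable
qed

private lemma improved_meas_M [measurable]: "improved \<in> borel_measurable M"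
  by (rule measurable_from_subalg[OF H(1) improved_measurable])

lemma le_improved: "U w \<le> improved w"
  by (simp add: improved_def)

lemma improved_minus: "w \<in> A \<Longrightarrow> improved w - S w = max (\<Lambda> w) (U w - S w)"
  by (simp add: improved_def max_def)

lemma improved_outside: "w \<notin> A \<Longrightarrow> improved w = U w"
  by (simp add: improved_def)

private lemma level_bound: "AE w in M. w \<in> A \<longrightarrow> \<Lambda> w \<le> crit"
  by (rule level_le_crit[OF _ lev]) measurable

text \<open>The level is controlled from above only, by \<open>crit\<close> on \<open>A\<close>, and
  this suffices because the positive part discards large negative values.\<close>

private lemma excess_part_integrable: "integrable M (\<lambda>w. max (S w - U w + \<Lambda> w) 0 * indicator A w)"
proof (rule Bochner_Integration.integrable_bound)
  show "integrable M (\<lambda>w. \<bar>S w\<bar> + \<bar>U w\<bar> + \<bar>crit\<bar>)"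
    using S U by auto
  show "AE w in M. norm (max (S w - U w + \<Lambda> w) 0 * indicator A w) \<le> norm (\<bar>S w\<bar> + \<bar>U w\<bar> + \<bar>crit\<bar>)"
    using level_bound by eventually_elim (auto simp: indicator_def)
qed measurable

lemma improved_integrable: "integrable M improved"
  unfolding improved_def[abs_def]
  using U(1) excess_part_integrable by (rule Bochner_Integration.integrable_add)

text \<open>On \<open>A\<close> the level equation gives equality; off \<open>A\<close> the variable
  \<open>U\<close> already satisfies the constraint, by the definition of the excess event.\<close>

lemma improved_feasible: "AE w in M. cexp M F (\<lambda>w. ereal (l (improved w - S w))) w \<le> ereal a"
proof -
  have "AE w in M. w \<in> A \<longrightarrow> cexp M F (\<lambda>w. ereal (l (improved w - S w))) w
      = cexp M F (\<lambda>w. ereal (l (max (\<Lambda> w) (U w - S w)))) w"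
    by (intro cexp_cong_on A_meas AE_I2) (auto simp: improved_minus)
  moreover have "AE w in M. w \<in> space M - A \<longrightarrow> cexp M F (\<lambda>w. ereal (l (improved w - S w))) w
      = cexp M F (\<lambda>w. ereal (l (U w - S w))) w"
    using space_in_subalg A_meas by (intro cexp_cong_on sets.Diff AE_I2) (auto simp: improved_outside)
  ultimately show ?thesis
    using level_cexp[OF lev] AE_space
    by eventually_elim (auto simp: excess_def not_less)
qed

lemma improved_optimal:
  assumes [measurable]: "N \<in> borel_measurable M" and ge: "AE w in M. U w \<le> N w"
    and feas: "AE w in M. cexp M F (\<lambda>w. ereal (l (N w - S w))) w \<le> ereal a"
  shows "AE w in M. ereal (real_cond_exp M F improved w) \<le> cexp M F (\<lambda>w. ereal (N w)) w"
proof -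
  define f where "f w = l (N w - S w)" for w
  define k where "k w = l (max (\<Lambda> w) (U w - S w))" for w
  \<comment> \<open>The reciprocal slope on the excess event, a Lagrange multiplier up to sign. It
    is set to 0 where \<open>\<Lambda>\<close> exceeds \<open>crit\<close>, which on the event
    happens only on a null set, so that its bound and sign hold everywhere.\<close>
  define r where "r w = (if \<Lambda> w \<le> crit then indicator A w / slope (\<Lambda> w) else 0)" for w
  have [measurable]: "f \<in> borel_measurable M" "k \<in> borel_measurable M"
    unfolding f_def[abs_def] k_def[abs_def] by measurable
  have r: "r \<in> borel_measurable F"
    unfolding r_def[abs_def] using level_meas by measurable
  note [measurable] = borel_measurable_subalg[OF r]
  have r_bound: "\<bar>r w\<bar> \<le> 1 / \<bar>slope crit\<bar>" and r_nonpos: "r w \<le> 0" for w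
  proof -
    have "1 / \<bar>slope (\<Lambda> w)\<bar> \<le> 1 / \<bar>slope crit\<bar>" if "\<Lambda> w \<le> crit"
      using slope_mono[OF that] slope_neg[of crit] by (intro frac_le) auto
    then show "\<bar>r w\<bar> \<le> 1 / \<bar>slope crit\<bar>"
      by (simp add: r_def indicator_def)
    show "r w \<le> 0"
      using slope_neg[of "\<Lambda> w"] by (simp add: r_def divide_nonneg_neg)
  qed
  have f_int: "integrable M f"
    unfolding f_def by (rule feasible_integrable) (use feas in auto)
  have fA_int: "integrable M (\<lambda>w. f w * indicator A w)"
    using f_int by (intro integrable_real_mult_indicator) auto
  have kA_int: "integrable M (\<lambda>w. k w * indicator A w)"
  proof (rule integrable_on_cexp_le[OF A_meas(1)])
    show "low \<le> k w" for w
      by (simp add: k_def low_le)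
    show "AE w in M. w \<in> A \<longrightarrow> cexp M F (\<lambda>w. ereal (k w)) w \<le> ereal a"
      using level_cexp[OF lev] unfolding k_def by eventually_elim simp
  qed measurable
  have d_int: "integrable M (\<lambda>w. f w * indicator A w - k w * indicator A w)"
    using fA_int kA_int by simp
  have rd_int: "integrable M (\<lambda>w. r w * (f w * indicator A w - k w * indicator A w))"
  proof (rule Bochner_Integration.integrable_bound)
    show "integrable M (\<lambda>w. (f w * indicator A w - k w * indicator A w) / \<bar>slope crit\<bar>)"
      using d_int by simp
    show "AE w in M. norm (r w * (f w * indicator A w - k w * indicator A w))
        \<le> norm ((f w * indicator A w - k w * indicator A w) / \<bar>slope crit\<bar>)"
    proof (rule AE_I2)
      fix w
      show "norm (r w * (f w * indicator A w - k w * indicator A w))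
        \<le> norm ((f w * indicator A w - k w * indicator A w) / \<bar>slope crit\<bar>)"
        using mult_right_mono[OF r_bound[of w], of "\<bar>f w * indicator A w - k w * indicator A w\<bar>"]
        by (simp add: abs_mult)
    qed
  qed measurable
  \<comment> \<open>The pointwise inequality \<open>lagrange\<close>, with \<open>f\<close> the loss
    of the competitor and \<open>k\<close> that of the candidate.\<close>
  have "AE w in M. ereal (improved w + r w * (f w * indicator A w - k w * indicator A w)) \<le> ereal (N w)"
    using ge level_bound
  proof eventually_elim
    fix w assume w: "U w \<le> N w" "w \<in> A \<longrightarrow> \<Lambda> w \<le> crit"
    show "ereal (improved w + r w * (f w * indicator A w - k w * indicator A w)) \<le> ereal (N w)"
    proof (cases "w \<in> A")
      case True
      then have "\<Lambda> w \<le> crit" using w by simp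
      then have "max (\<Lambda> w) (U w - S w) + (f w - k w) / slope (\<Lambda> w) \<le> N w - S w"
        unfolding f_def k_def using w by (intro lagrange) auto
      then show ?thesis
        using True improved_minus[OF True] \<open>\<Lambda> w \<le> crit\<close> by (simp add: r_def)
    next
      case False
      then show ?thesis using w by (simp add: improved_outside)
    qed
  qed
  then have "AE w in M. cexp M F (\<lambda>w. ereal (improved w + r w * (f w * indicator A w - k w * indicator A w))) w
      \<le> cexp M F (\<lambda>w. ereal (N w)) w"
    by (rule cexp_mono[rotated 2]) measurable
  moreover have "AE w in M. cexp M F (\<lambda>w. ereal (improved w + r w * (f w * indicator A w - k w * indicator A w))) w
      = ereal (real_cond_exp M F (\<lambda>w. improved w + r w * (f w * indicator A w - k w * indicator A w)) w)"
    by (rule cexp_eq_real_cond_exp[OF Bochner_Integration.integrable_add[OF improved_integrable rd_int]])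
  moreover have "AE w in M. real_cond_exp M F (\<lambda>w. improved w + r w * (f w * indicator A w - k w * indicator A w)) w
      = real_cond_exp M F improved w + real_cond_exp M F (\<lambda>w. r w * (f w * indicator A w - k w * indicator A w)) w"
    by (rule real_cond_exp_add[OF improved_integrable rd_int])
  moreover have "AE w in M. real_cond_exp M F (\<lambda>w. r w * (f w * indicator A w - k w * indicator A w)) w
      = r w * real_cond_exp M F (\<lambda>w. f w * indicator A w - k w * indicator A w) w"
    by (rule real_cond_exp_mult[OF r _ rd_int]) measurable
  moreover have "AE w in M. real_cond_exp M F (\<lambda>w. f w * indicator A w - k w * indicator A w) w
      = real_cond_exp M F (\<lambda>w. f w * indicator A w) w - real_cond_exp M F (\<lambda>w. k w * indicator A w) w"
    by (rule real_cond_exp_diff[OF fA_int kA_int])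
  moreover have "AE w in M. ereal (real_cond_exp M F (\<lambda>w. f w * indicator A w) w)
      = (if w \<in> A then cexp M F (\<lambda>w. ereal (f w)) w else 0)"
    by (rule real_cond_exp_indicator[OF A_meas(1) _ fA_int]) measurable
  moreover have "AE w in M. ereal (real_cond_exp M F (\<lambda>w. k w * indicator A w) w)
      = (if w \<in> A then cexp M F (\<lambda>w. ereal (k w)) w else 0)"
    by (rule real_cond_exp_indicator[OF A_meas(1) _ kA_int]) measurable
  ultimately show ?thesis
    using feas[folded f_def] level_cexp[OF lev, folded k_def]
  proof eventually_elim
    case (elim w)
    \<comment> \<open>On \<open>A\<close> the candidate spends the whole budget \<open>a\<close> and
      the competitor at most that; off \<open>A\<close> both sides vanish.\<close>
    have "real_cond_exp M F (\<lambda>w. f w * indicator A w) w \<le> real_cond_exp M F (\<lambda>w. k w * indicator A w) w"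
    proof (cases "w \<in> A")
      case True
      then have "ereal (real_cond_exp M F (\<lambda>w. f w * indicator A w) w)
          \<le> ereal (real_cond_exp M F (\<lambda>w. k w * indicator A w) w)"
        using elim(6-9) by simp
      then show ?thesis by simp
    next
      case False
      then show ?thesis using elim(6,7) by simp
    qed
    then have "0 \<le> r w * real_cond_exp M F (\<lambda>w. f w * indicator A w - k w * indicator A w) w"
      unfolding elim(5) by (intro mult_nonpos_nonpos r_nonpos) simp
    then have "ereal (real_cond_exp M F improved w)
        \<le> ereal (real_cond_exp M F (\<lambda>w. improved w + r w * (f w * indicator A w - k w * indicator A w)) w)"
      unfolding elim(3) elim(4) by simp
    also have "\<dots> \<le> cexp M F (\<lambda>w. ereal (N w)) w"
      using elim(1) unfolding elim(2) .
    finally show ?case .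
  qed
qed

lemma improved_value:
  assumes V: "AE w in M. V w = ereal (U w)"
    and inf: "is_ess_inf (restr_to_subalg M F) {cexp M F (\<lambda>w. ereal (N w)) |N. N \<in> admissible M F H l a S V} Z"
  shows "AE w in M. Z w = ereal (real_cond_exp M F improved w)"
proof (rule ess_inf_cexp_eq[OF inf])
  have "AE w in M. V w \<le> ereal (improved w)"
    using V by eventually_elim (simp add: le_improved)
  then show "improved \<in> admissible M F H l a S V"
    using improved_feasible improved_measurable by (simp add: admissible_def)
  show "integrable M improved"
    by (rule improved_integrable)
  fix N assume N: "N \<in> admissible M F H l a S V"
  then have "AE w in M. V w \<le> ereal (N w)"
    by (simp add: admissible_def)
  with V have "AE w in M. U w \<le> N w"
    by eventually_elim auto
  then show "AE w in M. ereal (real_cond_exp M F improved w) \<le> cexp M F (\<lambda>w. ereal (N w)) w"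
    using N by (intro improved_optimal) (auto simp: admissible_def intro: measurable_from_subalg[OF H(1)])
qed

text \<open>As \<open>A\<close> is an event of \<open>F\<close>, its indicator may stand inside or
  outside the conditional expectation of the gain.\<close>

lemma improved_formula:
  assumes [measurable]: "W \<in> borel_measurable M" and W: "AE w in M. W w = ereal (U w)"
  shows "AE w in M. cexp M F W w
      + cexp M F (\<lambda>w. max (ereal (S w) - W w + ereal (\<Lambda> w)) 0) w * indicator A w
      = ereal (real_cond_exp M F improved w)"
proof -
  let ?E = "\<lambda>w. max (S w - U w + \<Lambda> w) 0"
  have "AE w in M. cexp M F W w = cexp M F (\<lambda>w. ereal (U w)) w"
    using W by (intro cexp_cong_AE) auto
  moreover have "AE w in M. cexp M F (\<lambda>w. ereal (U w)) w = ereal (real_cond_exp M F U w)"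
    by (rule cexp_eq_real_cond_exp[OF U(1)])
  moreover have "AE w in M. cexp M F (\<lambda>w. max (ereal (S w) - W w + ereal (\<Lambda> w)) 0) w
      = cexp M F (\<lambda>w. ereal (?E w)) w"
    using W by (intro cexp_cong_AE) (auto elim!: eventually_mono simp: zero_ereal_def simp flip: ereal_max)
  moreover have "AE w in M. ereal (real_cond_exp M F (\<lambda>w. ?E w * indicator A w) w)
      = (if w \<in> A then cexp M F (\<lambda>w. ereal (?E w)) w else 0)"
    by (rule real_cond_exp_indicator[OF A_meas(1) _ excess_part_integrable]) measurable
  moreover have "AE w in M. real_cond_exp M F improved w
      = real_cond_exp M F U w + real_cond_exp M F (\<lambda>w. ?E w * indicator A w) w"
    unfolding improved_def[abs_def] by (rule real_cond_exp_add[OF U(1) excess_part_integrable])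
  ultimately show ?thesis
  proof eventually_elim
    case (elim w)
    then show ?case
      by (cases "w \<in> A") (simp_all flip: plus_ereal.simps(1))
  qed
qed

text \<open>On \<open>A\<close> the level is negative, so \<open>improved\<close> equals
  \<open>max U S\<close> minus the candidate loss, whose conditional expectation is
  \<open>a\<close>; this is the second entry of the maximum, and the first cannot exceed it because
  \<open>U \<le> improved\<close>. Off \<open>A\<close> the value is that of
  \<open>U = max U S - l (U - S)\<close>, whose conditional loss is at most \<open>a\<close>, so the
  first entry is the larger.\<close>

lemma improved_neg_part:
  assumes l: "l = (\<lambda>x. max (- x) 0)" and "a > 0"
  shows "AE w in M. real_cond_exp M F improved w
    = max (real_cond_exp M F U w) (real_cond_exp M F (\<lambda>w. max (U w) (S w) - a) w)"
proof -
  define k where "k w = l (max (\<Lambda> w) (U w - S w))" for w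
  define B where "B w = max (U w) (S w)" for w
  have [measurable]: "k \<in> borel_measurable M"
    unfolding k_def[abs_def] by measurable
  have crit: "crit < 0"
    using le_crit_iff[of 0] \<open>a > 0\<close> by (simp add: l)
  have B_int: "integrable M B"
    unfolding B_def[abs_def] using U S by (intro integrable_max)
  have kA_int: "integrable M (\<lambda>w. k w * indicator A w)"
  proof (rule integrable_on_cexp_le[OF A_meas(1)])
    show "low \<le> k w" for w
      by (simp add: k_def low_le)
    show "AE w in M. w \<in> A \<longrightarrow> cexp M F (\<lambda>w. ereal (k w)) w \<le> ereal a"
      using level_cexp[OF lev] unfolding k_def by eventually_elim simp
  qed measurable
  have n_int: "integrable M (\<lambda>w. l (U w - S w))"
    unfolding l using U S by (intro integrable_max) auto
  have B_eq: "(\<lambda>w. B w - l (U w - S w)) = U"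
    by (auto simp: B_def l max_def)
  have inside: "AE w in M. w \<in> A \<longrightarrow> real_cond_exp M F improved w
      = real_cond_exp M F (\<lambda>w. B w - k w * indicator A w) w"
    using level_bound improved_integrable B_int kA_int
  proof (intro real_cond_exp_cong_on A_meas Bochner_Integration.integrable_diff)
    show "AE w in M. w \<in> A \<longrightarrow> improved w = B w - k w * indicator A w"
      using level_bound
    proof (eventually_elim, intro impI)
      fix w assume w: "w \<in> A \<longrightarrow> \<Lambda> w \<le> crit" "w \<in> A"
      then have "improved w = S w + max (\<Lambda> w) (U w - S w)"
        using improved_minus[of w] by simp
      then show "improved w = B w - k w * indicator A w"
        using w crit by (simp add: k_def B_def l max_def)
    qed
  qed
  have "AE w in M. w \<in> space M - A \<longrightarrow> real_cond_exp M F improved w = real_cond_exp M F U w"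
    using space_in_subalg improved_integrable U(1)
    by (intro real_cond_exp_cong_on sets.Diff A_meas AE_I2) (auto simp: improved_outside)
  moreover have "AE w in M. real_cond_exp M F U w \<le> real_cond_exp M F improved w"
    using le_improved by (intro real_cond_exp_mono improved_integrable U) auto
  moreover have "AE w in M. real_cond_exp M F (\<lambda>w. B w - k w * indicator A w) w
      = real_cond_exp M F B w - real_cond_exp M F (\<lambda>w. k w * indicator A w) w"
    by (rule real_cond_exp_diff[OF B_int kA_int])
  moreover have "AE w in M. ereal (real_cond_exp M F (\<lambda>w. k w * indicator A w) w)
      = (if w \<in> A then cexp M F (\<lambda>w. ereal (k w)) w else 0)"
    by (rule real_cond_exp_indicator[OF A_meas(1) _ kA_int]) measurable
  moreover have "AE w in M. real_cond_exp M F U w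
      = real_cond_exp M F B w - real_cond_exp M F (\<lambda>w. l (U w - S w)) w"
    using real_cond_exp_diff[OF B_int n_int] unfolding B_eq .
  moreover have "AE w in M. real_cond_exp M F (\<lambda>w. B w - a) w
      = real_cond_exp M F B w - real_cond_exp M F (\<lambda>w. a) w"
    by (intro real_cond_exp_diff B_int) simp
  moreover have "AE w in M. real_cond_exp M F (\<lambda>w. a) w = a"
    by (intro real_cond_exp_F_meas) auto
  ultimately show ?thesis
    unfolding B_def[symmetric]
    using inside cexp_eq_real_cond_exp[OF n_int] level_cexp[OF lev, folded k_def] AE_space
  proof eventually_elim
    case (elim w)
    show ?case
    proof (cases "w \<in> A")
      case True
      then show ?thesis using elim by simp
    next
      case False
      then have "real_cond_exp M F (\<lambda>w. l (U w - S w)) w \<le> a"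
        using elim by (simp add: excess_def)
      then show ?thesis using elim False by simp
    qed
  qed
qed

end

text \<open>The one-step results concern real variables. Replacing an extended value by a real
  version alters the conditional expectations on null sets only.\<close>

lemma
  assumes [measurable]: "W \<in> borel_measurable M" "S \<in> borel_measurable M" "U \<in> borel_measurable M"
    and W: "AE w in M. W w = ereal (U w)"
  shows excess_cong: "AE w in M. w \<in> excess M F l a (\<lambda>w. W w - ereal (S w)) \<longleftrightarrow> w \<in> exc (\<lambda>w. U w - S w)"
    and level_cong: "is_level M F l a (\<lambda>w. W w - ereal (S w)) \<Lambda> \<longleftrightarrow> level (\<lambda>w. U w - S w) \<Lambda>"
proof -
  have "AE w in M. cexp M F (\<lambda>w. loss_ext l (W w - ereal (S w))) w
      = cexp M F (\<lambda>w. loss_ext l (ereal (U w - S w))) w"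
    using W by (intro cexp_cong_AE) (auto elim!: eventually_mono)
  then show exc: "AE w in M. w \<in> excess M F l a (\<lambda>w. W w - ereal (S w)) \<longleftrightarrow> w \<in> exc (\<lambda>w. U w - S w)"
    by eventually_elim (simp add: excess_def)
  show "is_level M F l a (\<lambda>w. W w - ereal (S w)) \<Lambda> \<longleftrightarrow> level (\<lambda>w. U w - S w) \<Lambda>"
  proof (cases "\<Lambda> \<in> borel_measurable F")
    case True
    note [measurable] = borel_measurable_subalg[OF True]
    have "AE w in M. cexp M F (\<lambda>w. loss_ext l (max (ereal (\<Lambda> w)) (W w - ereal (S w)))) w
        = cexp M F (\<lambda>w. loss_ext l (max (ereal (\<Lambda> w)) (ereal (U w - S w)))) w"
      using W by (intro cexp_cong_AE) (auto elim!: eventually_mono)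
    with exc have "AE w in M. (w \<in> excess M F l a (\<lambda>w. W w - ereal (S w)) \<longrightarrow>
        cexp M F (\<lambda>w. loss_ext l (max (ereal (\<Lambda> w)) (W w - ereal (S w)))) w = ereal a) \<longleftrightarrow>
        (w \<in> exc (\<lambda>w. U w - S w) \<longrightarrow>
        cexp M F (\<lambda>w. loss_ext l (max (ereal (\<Lambda> w)) (ereal (U w - S w)))) w = ereal a)"
      by eventually_elim simp
    then show ?thesis
      unfolding is_level_def using True by (auto elim: eventually_elim2)
  qed (simp add: is_level_def)
qed

end

section \<open>The value process\<close>

text \<open>A decreasing function converges to its infimum. Convergence is proved first because
  \<open>Lim\<close> denotes the limit only when one exists.\<close>

lemma Lim_at_top_less:
  fixes l :: "real \<Rightarrow> real"
  assumes "antimono l" "bdd_below (range l)" "Lim at_top l < a"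
  shows "\<exists>x. l x < a"
proof -
  have "(l \<longlongrightarrow> (INF x. l x)) at_top"
  proof (rule decreasing_tendsto)
    show "\<forall>\<^sub>F x in at_top. (INF x. l x) \<le> l x"
      using assms(2) by (auto intro!: always_eventually cINF_lower)
    fix y assume "(INF x. l x) < y"
    then obtain x where "l x < y"
      using assms(2) by (auto simp: cINF_less_iff)
    then have "l z < y" if "x \<le> z" for z
      using antimonoD[OF assms(1) that] by simp
    then show "\<forall>\<^sub>F x in at_top. l x < y"
      unfolding eventually_at_top_linorder by blast
  qed
  then have "Lim at_top l = (INF x. l x)"
    by (intro tendsto_Lim) auto
  with assms show ?thesis
    by (auto simp: cINF_less_iff)
qed

lemma explicit_value_step:
  assumes "explicit_value P F S l \<alpha> n \<Lambda> W" "Suc t < n"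
  shows "is_level P (F t) l (\<alpha> (Suc t)) (\<lambda>w. W (Suc t) w - ereal (S (Suc t) w)) (\<Lambda> (Suc t))"
    and "AE w in P. W t w = cexp P (F t) (W (Suc t)) w
      + cexp P (F t) (\<lambda>w. max (ereal (S (Suc t) w) - W (Suc t) w + ereal (\<Lambda> (Suc t) w)) 0) w
        * indicator (excess P (F t) l (\<alpha> (Suc t)) (\<lambda>w. W (Suc t) w - ereal (S (Suc t) w))) w"
proof -
  have "Suc t \<in> {1..<n}" using assms by simp
  note * = assms(1)[unfolded explicit_value_def, THEN conjunct2, THEN conjunct2, THEN bspec, OF this,
      unfolded diff_Suc_1]
  show "is_level P (F t) l (\<alpha> (Suc t)) (\<lambda>w. W (Suc t) w - ereal (S (Suc t) w)) (\<Lambda> (Suc t))"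
    by (rule *[THEN conjunct1])
  show "AE w in P. W t w = cexp P (F t) (W (Suc t)) w
      + cexp P (F t) (\<lambda>w. max (ereal (S (Suc t) w) - W (Suc t) w + ereal (\<Lambda> (Suc t) w)) 0) w
        * indicator (excess P (F t) l (\<alpha> (Suc t)) (\<lambda>w. W (Suc t) w - ereal (S (Suc t) w))) w"
    by (rule *[THEN conjunct2])
qed

section \<open>The backward recursion, and the case of a constant loss\<close>

locale hedging_problem = prob_space P for P :: "'a measure" +
  fixes F :: "nat \<Rightarrow> 'a measure" and n :: nat and S :: "nat \<Rightarrow> 'a \<Rightarrow> real"
    and l :: "real \<Rightarrow> real" and \<alpha> :: "nat \<Rightarrow> real" and V :: "nat \<Rightarrow> 'a \<Rightarrow> ereal"
  assumes n: "n \<ge> 1"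
    and sub: "\<And>k. k \<le> n \<Longrightarrow> subalgebra P (F k)"
    and filtration: "\<And>k. k < n \<Longrightarrow> subalgebra (F (Suc k)) (F k)"
    and S_meas: "\<And>k. k \<le> n \<Longrightarrow> S k \<in> borel_measurable (F k)"
    and S_int: "\<And>k. k \<le> n \<Longrightarrow> integrable P (S k)"
    and l: "convex_on UNIV l" "antimono l" "bdd_below (range l)"
    and value_process: "value_process P P F S l \<alpha> n V"
    and below: "\<And>k. k \<in> {1..n} \<Longrightarrow> \<exists>x. l x < \<alpha> k"
begin

lemma subalg_sigma: "k \<le> n \<Longrightarrow> finite_measure_subalgebra P (F k)"
  using sub by unfold_locales auto

lemma V_end: "V n = (\<lambda>_. -\<infinity>)"
  using value_process by (simp add: value_process_def)

lemma V_step: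
  assumes "t < n"
  shows "is_ess_inf (restr_to_subalg P (F t))
    {cexp P (F t) (\<lambda>w. ereal (M w)) |M. M \<in> admissible P (F t) (F (Suc t)) l (\<alpha> (Suc t)) (S (Suc t)) (V (Suc t))}
    (V t)"
  by (rule value_process[unfolded value_process_def, THEN conjunct2, THEN bspec, of "Suc t", unfolded diff_Suc_1])
    (use assms in simp)

text \<open>By backward induction every constant \<open>- real i\<close> is admissible, so the value
  lies below all of them.\<close>

lemma V_constant:
  assumes "l = (\<lambda>_. c)" "t < n"
  shows "AE w in P. V t w = -\<infinity>"
  using less_imp_le[OF assms(2)] assms(2)
proof (induction t rule: inc_induct)
  case (step t)
  interpret finite_measure_subalgebra P "F t"
    using step by (intro subalg_sigma) simp
  have "AE w in P. V (Suc t) w = -\<infinity>"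
    using step V_end by (cases "Suc t = n") auto
  moreover have "c < \<alpha> (Suc t)"
    using below[of "Suc t"] step assms(1) by simp
  with cexp_const[of "ereal c"] have cexp_le: "AE w in P. cexp P (F t) (\<lambda>_. ereal c) w \<le> ereal (\<alpha> (Suc t))"
    by (auto elim: eventually_mono)
  ultimately have "(\<lambda>_. - real i) \<in> admissible P (F t) (F (Suc t)) l (\<alpha> (Suc t)) (S (Suc t)) (V (Suc t))" for i
    using cexp_le assms(1) by (auto simp: admissible_def elim!: eventually_mono)
  then have "cexp P (F t) (\<lambda>w. ereal (- real i)) \<in> {cexp P (F t) (\<lambda>w. ereal (M w)) |M.
      M \<in> admissible P (F t) (F (Suc t)) l (\<alpha> (Suc t)) (S (Suc t)) (V (Suc t))}" for i
    by (intro CollectI exI[of _ "\<lambda>_. - real i"]) simp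
  then have "AE w in restr_to_subalg P (F t). V t w \<le> cexp P (F t) (\<lambda>w. ereal (- real i)) w" for i
    using V_step[of t] step by (simp add: is_ess_inf_def)
  then have le: "AE w in P. V t w \<le> cexp P (F t) (\<lambda>w. ereal (- real i)) w" for i
    by (rule AE_restr_to_subalg[OF subalg])
  have "AE w in P. V t w \<le> ereal (- real i)" for i
    using le[of i] cexp_const[of "ereal (- real i)"] by eventually_elim simp
  then have "AE w in P. \<forall>i. V t w \<le> ereal (- real i)"
    by (simp add: AE_all_countable)
  then show ?case
  proof eventually_elim
    case (elim w)
    show ?case
    proof (rule ereal_bot)
      fix r :: real
      obtain i where "- r \<le> real i" using real_arch_simple by blast
      then have "ereal (- real i) \<le> ereal r" by simp
      with elim show "V t w \<le> ereal r" by (meson order_trans)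
    qed
  qed
qed simp

lemma loss_ext_constant: "loss_ext (\<lambda>_. c) = (\<lambda>_. ereal c)"
  by (auto simp: loss_ext_def fun_eq_iff split: ereal.split)

text \<open>The conditional loss is almost surely the constant \<open>c\<close>, which lies below
  \<open>\<alpha> (Suc t)\<close>.\<close>

lemma excess_constant:
  assumes "l = (\<lambda>_. c)" "t < n"
  shows "AE w in P. w \<notin> excess P (F t) l (\<alpha> (Suc t)) Y"
proof -
  interpret finite_measure_subalgebra P "F t"
    using assms by (intro subalg_sigma) simp
  have "c < \<alpha> (Suc t)"
    using below[of "Suc t"] assms by simp
  with cexp_const[of "ereal c"] show ?thesis
    by (auto simp: excess_def assms(1) loss_ext_constant elim!: eventually_mono)
qed

lemma loss_inv_constant:
  assumes "l = (\<lambda>_. c)"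
  shows "loss_inv l (\<alpha> n) = -\<infinity>"
proof -
  have "c < \<alpha> n"
    using below[of n] n assms by simp
  then have "{x. l x \<le> \<alpha> n} = UNIV"
    using assms by auto
  then have "loss_inv l (\<alpha> n) \<le> ereal r" for r
    unfolding loss_inv_def by (intro INF_lower) auto
  then show ?thesis
    by (intro ereal_bot) auto
qed

lemma S_cexp_real: "AE w in P. cexp P (F (n - 1)) (\<lambda>w. ereal (S n w)) w = ereal (real_cond_exp P (F (n - 1)) (S n) w)"
proof -
  interpret finite_measure_subalgebra P "F (n - 1)"
    by (intro subalg_sigma) simp
  show ?thesis
    by (intro cexp_eq_real_cond_exp S_int) simp
qed

lemma explicit_constant:
  assumes c: "l = (\<lambda>_. c)" and W: "explicit_value P F S l \<alpha> n \<Lambda> W" and "t \<le> n - 1"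
  shows "AE w in P. W t w = -\<infinity>"
  using assms(3)
proof (induction t rule: inc_induct)
  case base
  have "AE w in P. W (n - 1) w = cexp P (F (n - 1)) (\<lambda>w. ereal (S n w)) w + loss_inv l (\<alpha> n)"
    using W by (simp add: explicit_value_def)
  with S_cexp_real show ?case
    by eventually_elim (simp add: loss_inv_constant[OF c])
next
  case (step t)
  interpret finite_measure_subalgebra P "F t"
    using step by (intro subalg_sigma) simp
  have k: "Suc t \<in> {1..<n}" using step by auto
  have "W (Suc t) \<in> borel_measurable P"
    using W k sub[of "Suc t"] by (auto simp: explicit_value_def intro: measurable_from_subalg)
  then have "AE w in P. cexp P (F t) (W (Suc t)) w = cexp P (F t) (\<lambda>_. -\<infinity>) w"
    using step.IH by (intro cexp_cong_AE) auto
  moreover have "AE w in P. w \<notin> excess P (F t) l (\<alpha> (Suc t)) (\<lambda>w. W (Suc t) w - ereal (S (Suc t) w))"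
    using k by (intro excess_constant[OF c]) simp
  moreover have "Suc t < n" using k by simp
  note explicit_value_step(2)[OF W this]
  ultimately show ?case
    using cexp_const[of "-\<infinity>"] by eventually_elim simp
qed

text \<open>The excess event is null, so any level serves, here 0, and the term containing it is
  multiplied by 0 almost surely.\<close>

lemma explicit_constant_exists:
  assumes c: "l = (\<lambda>_. c)"
  shows "explicit_value P F S l \<alpha> n (\<lambda>_ _. 0) (\<lambda>_ _. -\<infinity>)"
  unfolding explicit_value_def
proof (intro conjI ballI allI impI)
  show "AE w in P. -\<infinity> = cexp P (F (n - 1)) (\<lambda>w. ereal (S n w)) w + loss_inv l (\<alpha> n)"
    using S_cexp_real by eventually_elim (simp add: loss_inv_constant[OF c])
next
  fix k assume "k \<in> {1..<n}"
  then obtain t where t: "k = Suc t" "t < n"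
    by (cases k) auto
  interpret finite_measure_subalgebra P "F t"
    using t by (intro subalg_sigma) simp
  have exc: "AE w in P. w \<notin> excess P (F (k - 1)) l (\<alpha> k) (\<lambda>w. -\<infinity> - ereal (S k w))"
    using excess_constant[OF c t(2)] t by simp
  then show "is_level P (F (k - 1)) l (\<alpha> k) (\<lambda>w. -\<infinity> - ereal (S k w)) (\<lambda>_. 0)"
    by (auto simp: is_level_def elim: eventually_mono)
  show "AE w in P. -\<infinity> = cexp P (F (k - 1)) (\<lambda>_. -\<infinity>) w
      + cexp P (F (k - 1)) (\<lambda>w. max (ereal (S k w) - -\<infinity> + ereal 0) 0) w
        * indicator (excess P (F (k - 1)) l (\<alpha> k) (\<lambda>w. -\<infinity> - ereal (S k w))) w"
    using exc cexp_const[of "-\<infinity>"] unfolding t(1) diff_Suc_1 by eventually_elim simp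
qed simp

end

section \<open>The backward recursion for a nonconstant loss\<close>

locale nonconstant_hedging_problem = hedging_problem +
  assumes nonconstant: "\<exists>x y. l x \<noteq> l y"
begin

lemma level_problem: "t < n \<Longrightarrow> level_problem P (F t) l (\<alpha> (Suc t))"
  using l nonconstant below[of "Suc t"] sub[of t] by unfold_locales auto

lemma V_base:
  "AE w in P. V (n - 1) w = ereal (real_cond_exp P (F (n - 1)) (\<lambda>w. S n w + loss_level.crit l (\<alpha> n)) w)"
proof -
  interpret L: level_problem P "F (n - 1)" l "\<alpha> n"
    using level_problem[of "n - 1"] n by simp
  show ?thesis
    using n V_step[of "n - 1"] by (intro L.terminal_value[OF sub S_int S_meas V_end]) auto
qed

lemma base_value:
  "AE w in P. cexp P (F (n - 1)) (\<lambda>w. ereal (S n w)) w + loss_inv l (\<alpha> n)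
    = ereal (real_cond_exp P (F (n - 1)) (\<lambda>w. S n w + loss_level.crit l (\<alpha> n)) w)"
proof -
  interpret L: level_problem P "F (n - 1)" l "\<alpha> n"
    using level_problem[of "n - 1"] n by simp
  have "AE w in P. real_cond_exp P (F (n - 1)) (\<lambda>w. S n w + L.crit) w
      = real_cond_exp P (F (n - 1)) (S n) w + real_cond_exp P (F (n - 1)) (\<lambda>_. L.crit) w"
    using S_int[of n] by (intro L.real_cond_exp_add) auto
  moreover have "AE w in P. real_cond_exp P (F (n - 1)) (\<lambda>_. L.crit) w = L.crit"
    by (intro L.real_cond_exp_F_meas) auto
  ultimately show ?thesis
    using S_cexp_real by eventually_elim (simp add: L.loss_inv_eq)
qed

text \<open>The invariant of the backward inductions. One real version serves both \<open>Z\<close>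
  and \<open>V t\<close>; its integrability and measurability are what the one-step lemmas require
  of the next value.\<close>

definition solves :: "nat \<Rightarrow> ('a \<Rightarrow> ereal) \<Rightarrow> bool" where
  "solves t Z \<longleftrightarrow> (\<exists>U. U \<in> borel_measurable (F t) \<and> integrable P U \<and>
     (AE w in P. Z w = ereal (U w)) \<and> (AE w in P. V t w = ereal (U w)))"

lemma solvesI:
  assumes "t < n" "integrable P T"
    and "AE w in P. Z w = ereal (real_cond_exp P (F t) T w)"
    and "AE w in P. V t w = ereal (real_cond_exp P (F t) T w)"
  shows "solves t Z"
proof -
  interpret finite_measure_subalgebra P "F t"
    using assms by (intro subalg_sigma) simp
  have "integrable P (real_cond_exp P (F t) T)"
    by (rule real_cond_exp_int[OF assms(2)])
  then show ?thesis
    unfolding solves_def using assms(3,4)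
    by (intro exI[of _ "real_cond_exp P (F t) T"] conjI) simp_all
qed

lemma solves_base:
  assumes "AE w in P. Z w = ereal (real_cond_exp P (F (n - 1)) (\<lambda>w. S n w + loss_level.crit l (\<alpha> n)) w)"
  shows "solves (n - 1) Z"
  using n S_int[of n] by (intro solvesI[OF _ _ assms V_base]) auto

lemma step_conditions:
  assumes "Suc t < n" "U \<in> borel_measurable (F (Suc t))"
  shows "subalgebra P (F (Suc t))" "subalgebra (F (Suc t)) (F t)"
    "S (Suc t) \<in> borel_measurable (F (Suc t))" "integrable P (S (Suc t))"
    "S (Suc t) \<in> borel_measurable P" "U \<in> borel_measurable P"
  using assms sub[of "Suc t"] filtration[of t] S_meas[of "Suc t"] S_int[of "Suc t"]
  by (auto intro: measurable_from_subalg)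

text \<open>At each step the explicit formula and the essential infimum are both identified with the
  conditional expectation of the same \<open>improved\<close> variable, which is integrable, so the
  invariant moves back one time.\<close>

lemma explicit_solves:
  assumes W: "explicit_value P F S l \<alpha> n \<Lambda> W" and "t \<le> n - 1"
  shows "solves t (W t)"
  using assms(2)
proof (induction t rule: inc_induct)
  case base
  have "AE w in P. W (n - 1) w = cexp P (F (n - 1)) (\<lambda>w. ereal (S n w)) w + loss_inv l (\<alpha> n)"
    using W by (simp add: explicit_value_def)
  with base_value show ?case
    by (intro solves_base) (auto elim: eventually_elim2)
next
  case (step t)
  let ?k = "Suc t"
  have k: "?k \<in> {1..<n}" using step by auto
  interpret L: level_problem P "F t" l "\<alpha> ?k"
    using k by (intro level_problem) simp
  from step.IH obtain U where U: "U \<in> borel_measurable (F ?k)" "integrable P U"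
    "AE w in P. W ?k w = ereal (U w)" "AE w in P. V ?k w = ereal (U w)"
    unfolding solves_def by blast
  have "?k < n" using k by simp
  note c = step_conditions[OF this U(1)]
  have Wm: "W ?k \<in> borel_measurable P"
    using W k c(1) by (auto simp: explicit_value_def intro: measurable_from_subalg)
  have lev: "L.level (\<lambda>w. U w - S ?k w) (\<Lambda> ?k)"
    using explicit_value_step(1)[OF W \<open>?k < n\<close>] unfolding L.level_cong[OF Wm c(5,6) U(3)] .
  let ?T = "L.improved U (S ?k) (\<Lambda> ?k)"
  from explicit_value_step(2)[OF W \<open>?k < n\<close>] L.improved_formula[OF c(1,2) U(2,1) c(4,3) lev Wm U(3)] L.excess_cong[OF Wm c(5,6) U(3)]
  have "AE w in P. W t w = ereal (real_cond_exp P (F t) ?T w)"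
    by eventually_elim (simp add: indicator_def)
  moreover have "AE w in P. V t w = ereal (real_cond_exp P (F t) ?T w)"
    using k by (intro L.improved_value[OF c(1,2) U(2,1) c(4,3) lev U(4)] V_step) simp
  ultimately show ?case
    using k L.improved_integrable[OF c(1,2) U(2,1) c(4,3) lev] by (intro solvesI) auto
qed

text \<open>By \<open>explicit_solves\<close> the value \<open>W k\<close> has a real version, to
  which the one-step uniqueness of levels applies.\<close>

lemma explicit_level_unique:
  assumes W: "explicit_value P F S l \<alpha> n \<Lambda> W" and k: "k \<in> {1..<n}"
    and lev': "is_level P (F (k - 1)) l (\<alpha> k) (\<lambda>w. W k w - ereal (S k w)) \<Lambda>'"
  shows "AE w in P. w \<in> excess P (F (k - 1)) l (\<alpha> k) (\<lambda>w. W k w - ereal (S k w)) \<longrightarrow> \<Lambda>' w = \<Lambda> k w"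
proof -
  obtain t where t: "k = Suc t" "Suc t < n"
    using k by (cases k) auto
  interpret L: level_problem P "F t" l "\<alpha> k"
    using t level_problem[of t] by simp
  have "k \<le> n - 1" using k by auto
  from explicit_solves[OF W this] obtain U where U: "U \<in> borel_measurable (F k)"
    "AE w in P. W k w = ereal (U w)"
    unfolding solves_def by blast
  note c = step_conditions[OF t(2) U(1)[unfolded t(1)], folded t(1)]
  have Wm: "W k \<in> borel_measurable P"
    using W k c(1) by (auto simp: explicit_value_def intro: measurable_from_subalg)
  note cong = L.level_cong[OF Wm c(5,6) U(2)]
  have "is_level P (F t) l (\<alpha> k) (\<lambda>w. W k w - ereal (S k w)) (\<Lambda> k)"
    using explicit_value_step(1)[OF W t(2)] unfolding t(1) .
  moreover have "is_level P (F t) l (\<alpha> k) (\<lambda>w. W k w - ereal (S k w)) \<Lambda>'"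
    using lev' t(1) by simp
  ultimately have "AE w in P. w \<in> L.exc (\<lambda>w. U w - S k w) \<longrightarrow> \<Lambda>' w = \<Lambda> k w"
    using c(5,6) by (intro L.level_unique) (simp_all add: cong)
  with L.excess_cong[OF Wm c(5,6) U(2)] show ?thesis
    unfolding t(1) diff_Suc_1 by eventually_elim simp
qed

text \<open>A partial solution on the times from \<open>t\<close> on, real and integrable so that it
  can be extended one step further back.\<close>

definition explicit_from :: "nat \<Rightarrow> (nat \<Rightarrow> 'a \<Rightarrow> real) \<Rightarrow> (nat \<Rightarrow> 'a \<Rightarrow> real) \<Rightarrow> bool" where
  "explicit_from t \<Lambda> U \<longleftrightarrow>
     (\<forall>s\<in>{t..<n}. U s \<in> borel_measurable (F s) \<and> integrable P (U s)) \<and>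
     (AE w in P. ereal (U (n - 1) w) = cexp P (F (n - 1)) (\<lambda>w. ereal (S n w)) w + loss_inv l (\<alpha> n)) \<and>
     (\<forall>k\<in>{Suc t..<n}.
        is_level P (F (k - 1)) l (\<alpha> k) (\<lambda>w. ereal (U k w) - ereal (S k w)) (\<Lambda> k) \<and>
        (AE w in P. ereal (U (k - 1) w) =
           cexp P (F (k - 1)) (\<lambda>w. ereal (U k w)) w
           + cexp P (F (k - 1)) (\<lambda>w. max (ereal (S k w) - ereal (U k w) + ereal (\<Lambda> k w)) 0) w
             * indicator (excess P (F (k - 1)) l (\<alpha> k) (\<lambda>w. ereal (U k w) - ereal (S k w))) w))"

lemma explicit_from_exists: "t \<le> n - 1 \<Longrightarrow> \<exists>\<Lambda> U. explicit_from t \<Lambda> U"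
proof (induction t rule: inc_induct)
  case base
  interpret L: level_problem P "F (n - 1)" l "\<alpha> n"
    using level_problem[of "n - 1"] n by simp
  let ?U = "real_cond_exp P (F (n - 1)) (\<lambda>w. S n w + L.crit)"
  have "integrable P ?U"
    using S_int[of n] by (intro L.real_cond_exp_int) auto
  moreover have "AE w in P. ereal (?U w) = cexp P (F (n - 1)) (\<lambda>w. ereal (S n w)) w + loss_inv l (\<alpha> n)"
    using base_value by eventually_elim (rule sym)
  moreover have "{n - 1..<n} = {n - 1}" "{Suc (n - 1)..<n} = {}"
    using n by auto
  ultimately have "explicit_from (n - 1) (\<lambda>_ _. 0) (\<lambda>_. ?U)"
    unfolding explicit_from_def by (intro conjI) simp_all
  then show ?case by blast
next
  case (step t)
  let ?k = "Suc t"
  have k: "?k < n" using step by auto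
  interpret L: level_problem P "F t" l "\<alpha> ?k"
    using k by (intro level_problem) simp
  from step.IH obtain \<Lambda> U where IH: "explicit_from ?k \<Lambda> U" by blast
  then have U: "integrable P (U ?k)" "U ?k \<in> borel_measurable (F ?k)"
    using k by (auto simp: explicit_from_def)
  note c = step_conditions[OF k U(2)]
  obtain L0 where lev: "L.level (\<lambda>w. U ?k w - S ?k w) L0"
    using L.level_exists[of "\<lambda>w. U ?k w - S ?k w"] c(5,6) by auto
  let ?T = "real_cond_exp P (F t) (L.improved (U ?k) (S ?k) L0)"
  \<comment> \<open>The equation with index \<open>Suc t\<close> uses the level at
    \<open>Suc t\<close> but determines the value at \<open>t\<close>, so the two families are
    updated at different indices.\<close>
  define \<Lambda>' where "\<Lambda>' = \<Lambda>(?k := L0)"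
  define U' where "U' = U(t := ?T)"
  have T_int: "integrable P ?T"
    by (intro L.real_cond_exp_int L.improved_integrable[OF c(1,2) U c(4,3) lev])
  have upd: "\<Lambda>' ?k = L0" "U' t = ?T" "\<And>s. s \<noteq> ?k \<Longrightarrow> \<Lambda>' s = \<Lambda> s" "\<And>s. s \<noteq> t \<Longrightarrow> U' s = U s"
    by (auto simp: \<Lambda>'_def U'_def)
  have "explicit_from t \<Lambda>' U'"
    unfolding explicit_from_def
  proof (intro conjI ballI)
    fix s assume s: "s \<in> {t..<n}"
    show "U' s \<in> borel_measurable (F s)" "integrable P (U' s)"
      using s IH T_int upd(2) upd(4)[of s] by (cases "s = t"; simp add: explicit_from_def)+
  next
    show "AE w in P. ereal (U' (n - 1) w) = cexp P (F (n - 1)) (\<lambda>w. ereal (S n w)) w + loss_inv l (\<alpha> n)"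
      using IH k upd(4)[of "n - 1"] by (simp add: explicit_from_def)
  next
    fix k' assume k': "k' \<in> {Suc t..<n}"
    then have ne: "k' \<noteq> t" by simp
    show "is_level P (F (k' - 1)) l (\<alpha> k') (\<lambda>w. ereal (U' k' w) - ereal (S k' w)) (\<Lambda>' k')"
    proof (cases "k' = ?k")
      case True
      then show ?thesis using lev upd(1) upd(4)[OF ne] by simp
    next
      case False
      then show ?thesis
        using IH k' upd(3)[OF False] upd(4)[OF ne] unfolding explicit_from_def by simp
    qed
    show "AE w in P. ereal (U' (k' - 1) w) =
           cexp P (F (k' - 1)) (\<lambda>w. ereal (U' k' w)) w
           + cexp P (F (k' - 1)) (\<lambda>w. max (ereal (S k' w) - ereal (U' k' w) + ereal (\<Lambda>' k' w)) 0) w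
             * indicator (excess P (F (k' - 1)) l (\<alpha> k') (\<lambda>w. ereal (U' k' w) - ereal (S k' w))) w"
    proof (cases "k' = ?k")
      case True
      have "AE w in P. ereal (?T w) = cexp P (F t) (\<lambda>w. ereal (U ?k w)) w
          + cexp P (F t) (\<lambda>w. max (ereal (S ?k w) - ereal (U ?k w) + ereal (L0 w)) 0) w
          * indicator (L.exc (\<lambda>w. U ?k w - S ?k w)) w"
        using L.improved_formula[OF c(1,2) U c(4,3) lev, of "\<lambda>w. ereal (U ?k w)"] c(6)
        by (auto elim: eventually_mono)
      then show ?thesis
        unfolding True diff_Suc_1 upd(1,2) upd(4)[OF n_not_Suc_n[symmetric]] ereal_minus(1) .
    next
      case False
      then have "k' - 1 \<noteq> t" using k' by auto
      then show ?thesis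
        using IH k' False unfolding explicit_from_def upd(3)[OF False] upd(4)[OF ne] upd(4)[OF \<open>k' - 1 \<noteq> t\<close>]
        by simp
    qed
  qed
  then show ?case by blast
qed

lemma explicit_exists: "\<exists>\<Lambda> W. explicit_value P F S l \<alpha> n \<Lambda> W"
proof -
  obtain \<Lambda> U where U: "explicit_from 0 \<Lambda> U"
    using explicit_from_exists[of 0] by auto
  have "explicit_value P F S l \<alpha> n \<Lambda> (\<lambda>t w. ereal (U t w))"
    unfolding explicit_value_def
  proof (intro conjI allI impI)
    show "(\<lambda>w. ereal (U t w)) \<in> borel_measurable (F t)" if "t < n" for t
      using U that by (intro borel_measurable_ereal) (simp add: explicit_from_def)
  qed (use U in \<open>simp_all add: explicit_from_def\<close>)
  then show ?thesis by blast
qed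

text \<open>The second formula contains no level. One is taken from \<open>level_exists\<close> at
  each step, and \<open>improved_neg_part\<close> shows that the resulting value has the required
  form.\<close>

lemma explicit_neg_part_solves:
  assumes l_eq: "l = (\<lambda>x. max (- x) 0)" and pos: "\<And>k. k \<in> {1..n} \<Longrightarrow> \<alpha> k > 0"
    and W: "explicit_value_neg_part P F S \<alpha> n W" and "t \<le> n - 1"
  shows "solves t (W t)"
  using assms(4)
proof (induction t rule: inc_induct)
  case base
  interpret L: level_problem P "F (n - 1)" l "\<alpha> n"
    using level_problem[of "n - 1"] n by simp
  have "0 < \<alpha> n" using pos[of n] n by simp
  \<comment> \<open>For positive \<open>\<alpha> n\<close> the negative part takes this value
    exactly at \<open>- \<alpha> n\<close>.\<close>
  then have "L.crit = - \<alpha> n"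
    using L.le_crit_iff[of "- \<alpha> n"] L.crit_le_iff[of "- \<alpha> n"] by (simp add: l_eq)
  then have "cexp P (F (n - 1)) (\<lambda>w. ereal (S n w)) w - ereal (\<alpha> n)
      = cexp P (F (n - 1)) (\<lambda>w. ereal (S n w)) w + loss_inv l (\<alpha> n)" for w
    by (simp add: L.loss_inv_eq minus_ereal_def)
  moreover have "AE w in P. W (n - 1) w = cexp P (F (n - 1)) (\<lambda>w. ereal (S n w)) w - ereal (\<alpha> n)"
    using W by (simp add: explicit_value_neg_part_def)
  ultimately show ?case
    using base_value by (intro solves_base) (auto elim: eventually_elim2)
next
  case (step t)
  let ?k = "Suc t"
  have k: "?k \<in> {1..<n}" using step by auto
  interpret L: level_problem P "F t" l "\<alpha> ?k"
    using k by (intro level_problem) simp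
  from step.IH obtain U where U: "U \<in> borel_measurable (F ?k)" "integrable P U"
    "AE w in P. W ?k w = ereal (U w)" "AE w in P. V ?k w = ereal (U w)"
    unfolding solves_def by blast
  have "?k < n" using k by simp
  note c = step_conditions[OF this U(1)]
  note [measurable] = c(5,6)
  have Wm [measurable]: "W ?k \<in> borel_measurable P"
    using W k c(1) by (auto simp: explicit_value_neg_part_def intro: measurable_from_subalg)
  obtain L0 where lev: "L.level (\<lambda>w. U w - S ?k w) L0"
    using L.level_exists[of "\<lambda>w. U w - S ?k w"] by auto
  let ?T = "L.improved U (S ?k) L0"
  have B_int: "integrable P (\<lambda>w. max (U w) (S ?k w) - \<alpha> ?k)"
    using U(2) c(4) by (intro Bochner_Integration.integrable_diff integrable_max) auto
  have "AE w in P. W t w = max (cexp P (F t) (W ?k) w)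
      (cexp P (F t) (\<lambda>w. max (W ?k w) (ereal (S ?k w)) - ereal (\<alpha> ?k)) w)"
    by (rule W[unfolded explicit_value_neg_part_def, THEN conjunct2, THEN conjunct2, THEN bspec, OF k,
          unfolded diff_Suc_1])
  moreover have "AE w in P. cexp P (F t) (W ?k) w = cexp P (F t) (\<lambda>w. ereal (U w)) w"
    using U(3) by (intro L.cexp_cong_AE) auto
  moreover have "AE w in P. cexp P (F t) (\<lambda>w. max (W ?k w) (ereal (S ?k w)) - ereal (\<alpha> ?k)) w
      = cexp P (F t) (\<lambda>w. ereal (max (U w) (S ?k w) - \<alpha> ?k)) w"
    using U(3) by (intro L.cexp_cong_AE) (auto elim!: eventually_mono simp flip: ereal_max)
  moreover have "AE w in P. real_cond_exp P (F t) ?T w = max (real_cond_exp P (F t) U w)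
      (real_cond_exp P (F t) (\<lambda>w. max (U w) (S ?k w) - \<alpha> ?k) w)"
    using k by (intro L.improved_neg_part[OF c(1,2) U(2,1) c(4,3) lev l_eq] pos) auto
  ultimately have "AE w in P. W t w = ereal (real_cond_exp P (F t) ?T w)"
    using L.cexp_eq_real_cond_exp[OF U(2)] L.cexp_eq_real_cond_exp[OF B_int]
    by eventually_elim simp
  moreover have "AE w in P. V t w = ereal (real_cond_exp P (F t) ?T w)"
    using k by (intro L.improved_value[OF c(1,2) U(2,1) c(4,3) lev U(4)] V_step) simp
  ultimately show ?case
    using k L.improved_integrable[OF c(1,2) U(2,1) c(4,3) lev] by (intro solvesI) auto
qed

lemma solves_eq: "solves t Z \<Longrightarrow> AE w in P. V t w = Z w"
  unfolding solves_def by (auto elim: eventually_elim2)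

end

theorem proposition8:
  fixes P Q :: "'a measure"
    and F :: "nat \<Rightarrow> 'a measure"
    and n :: nat
    and X S :: "nat \<Rightarrow> 'a \<Rightarrow> real"
    and l :: "real \<Rightarrow> real"
    and \<alpha> :: "nat \<Rightarrow> real"
    and V :: "nat \<Rightarrow> 'a \<Rightarrow> ereal"
  assumes "prob_space P" and "prob_space Q"
    and "sets Q = sets P" and "null_sets Q = null_sets P"
    and "n \<ge> 1"
    and "\<And>k. k \<le> n \<Longrightarrow> subalgebra P (F k)"
    and "\<And>k. k < n \<Longrightarrow> subalgebra (F (Suc k)) (F k)"
    and "\<And>A. A \<in> sets (F 0) \<Longrightarrow> measure P A = 0 \<or> measure P A = 1"
    and "\<And>i. i \<in> {1..n} \<Longrightarrow> X i \<in> borel_measurable (F i)"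
    and "\<And>i. i \<in> {1..n} \<Longrightarrow> integrable Q (X i)"
    and "\<And>k. S k = (\<lambda>\<omega>. \<Sum>i=1..k. X i \<omega>)"
    and "convex_on UNIV l" and "antimono l" and "bdd_below (range l)"
    and "value_process P Q F S l \<alpha> n V"
    and "P = Q"
    and "\<And>k. k \<in> {1..n} \<Longrightarrow> Lim at_top l < \<alpha> k"
  shows "(\<exists>\<Lambda> W. explicit_value P F S l \<alpha> n \<Lambda> W) \<and>
         (\<forall>\<Lambda> W. explicit_value P F S l \<alpha> n \<Lambda> W \<longrightarrow>
            (\<forall>t<n. AE \<omega> in P. V t \<omega> = W t \<omega>) \<and>
            (\<forall>k\<in>{1..<n}. \<forall>\<Lambda>'. is_level P (F (k - 1)) l (\<alpha> k) (\<lambda>w. W k w - ereal (S k w)) \<Lambda>' \<longrightarrow>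
               (AE \<omega> in P. \<omega> \<in> excess P (F (k - 1)) l (\<alpha> k) (\<lambda>w. W k w - ereal (S k w)) \<longrightarrow>
                  \<Lambda>' \<omega> = \<Lambda> k \<omega>))) \<and>
         ((l = (\<lambda>x. max (- x) 0) \<and> (\<forall>k\<in>{1..n}. \<alpha> k > 0)) \<longrightarrow>
            (\<forall>W. explicit_value_neg_part P F S \<alpha> n W \<longrightarrow> (\<forall>t<n. AE \<omega> in P. V t \<omega> = W t \<omega>)))"
proof -
  interpret prob_space P by fact
  have S_meas: "S k \<in> borel_measurable (F k)" if "k \<le> n" for k
  proof -
    have "subalgebra (F k) (F i)" if "i \<le> k" for i
      using that
    proof (induction i rule: inc_induct)
      case base
      show ?case by (simp add: subalgebra_def)
    next
      case (step i)
      then show ?case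
        using \<open>k \<le> n\<close> assms(7)[of i] by (auto simp: subalgebra_def)
    qed
    then have "X i \<in> borel_measurable (F k)" if "i \<in> {1..k}" for i
      using that assms(9)[of i] \<open>k \<le> n\<close> by (auto intro: measurable_from_subalg)
    then show ?thesis
      unfolding assms(11) by (intro borel_measurable_sum) auto
  qed
  have S_int: "integrable P (S k)" if "k \<le> n" for k
    unfolding assms(11) using assms(10,16) that by (intro Bochner_Integration.integrable_sum) auto
  interpret hedging_problem P F n S l \<alpha> V
    using assms S_meas S_int Lim_at_top_less[OF assms(13,14)] by unfold_locales auto
  show ?thesis
  \<comment> \<open>A constant loss never attains the levels, so it falls outside
    \<open>loss_level\<close> and is treated separately.\<close>
  proof (cases "\<exists>x y. l x \<noteq> l y")
    case True
    then interpret nonconstant_hedging_problem P F n S l \<alpha> V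
      by unfold_locales
    show ?thesis
    proof (intro conjI allI impI ballI explicit_exists solves_eq)
      fix \<Lambda> W t assume "explicit_value P F S l \<alpha> n \<Lambda> W" "t < n"
      then show "solves t (W t)" by (intro explicit_solves) auto
    next
      fix \<Lambda> W k \<Lambda>'
      assume "explicit_value P F S l \<alpha> n \<Lambda> W" "k \<in> {1..<n}"
        "is_level P (F (k - 1)) l (\<alpha> k) (\<lambda>w. W k w - ereal (S k w)) \<Lambda>'"
      then show "AE \<omega> in P. \<omega> \<in> excess P (F (k - 1)) l (\<alpha> k) (\<lambda>w. W k w - ereal (S k w)) \<longrightarrow> \<Lambda>' \<omega> = \<Lambda> k \<omega>"
        by (rule explicit_level_unique)
    next
      fix W t
      assume "l = (\<lambda>x. max (- x) 0) \<and> (\<forall>k\<in>{1..n}. \<alpha> k > 0)" "explicit_value_neg_part P F S \<alpha> n W" "t < n"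
      then show "solves t (W t)" by (intro explicit_neg_part_solves) auto
    qed
  next
    case False
    then obtain c where c: "l = (\<lambda>_. c)" by metis
    have "AE w in P. V t w = W t w" if "explicit_value P F S l \<alpha> n \<Lambda> W" "t < n" for \<Lambda> W t
    proof -
      have "t \<le> n - 1" using that(2) by simp
      from V_constant[OF c that(2)] explicit_constant[OF c that(1) this] show ?thesis
        by eventually_elim simp
    qed
    moreover have "AE w in P. w \<in> excess P (F (k - 1)) l (\<alpha> k) Y \<longrightarrow> \<Lambda>' w = \<Lambda> w"
      if "k \<in> {1..<n}" for k Y and \<Lambda> \<Lambda>' :: "'a \<Rightarrow> real"
    proof -
      have "k - 1 < n" "Suc (k - 1) = k" using that by auto
      with excess_constant[OF c, of "k - 1" Y] have "AE w in P. w \<notin> excess P (F (k - 1)) l (\<alpha> k) Y"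
        by simp
      then show ?thesis
        by eventually_elim simp
    qed
    \<comment> \<open>The negative part takes different values at 1 and -1, so the claim about that
      loss is vacuous here.\<close>
    moreover have "l \<noteq> (\<lambda>x. max (- x) 0)"
    proof
      assume "l = (\<lambda>x. max (- x) 0)"
      then have "max (- 1) 0 = c" "max 1 0 = c"
        using c by (metis, metis minus_minus)
      then show False by simp
    qed
    ultimately show ?thesis
      using explicit_constant_exists[OF c] by blast
  qed
qed

end
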